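(* There exist convex bodies $S$ and $K$ in $\mathbb{R}^4$ such that $K$ is $S$-Kakeya but there are two $S$-copies which cannot be rotated into each other within $K$; that is, there exist $\rho_0,\rho_1\in\operatorname{SO}(4)$ and $w_0,w_1\in\mathbb{R}^4$ with $\rho_i(S)+w_i\subseteq K$ for $i=0,1$, such that there are no continuous functions $\gamma:[0,1]\to\operatorname{SO}(4)$ and $\delta:[0,1]\to\mathbb{R}^4$ satisfying $\gamma(i)=\rho_i$, $\delta(i)=w_i$ for $i=0,1$ and $\gamma(t)(S)+\delta(t)\subseteq K$ for all $t\in[0,1]$.
   Context: A convex body is a compact convex set. For $S\subseteq\mathbb{R}^d$, a set $K\subseteq\mathbb{R}^d$ is called $S$-Kakeya if for every $\rho\in\operatorname{SO}(d)$ there is some $w\in\mathbb{R}^d$ such that $\rho(S)+w\subseteq K$. *)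

theory Defs
  imports "HOL-Analysis.Analysis"
begin

definition convex_body :: "'a::euclidean_space set \<Rightarrow> bool" where
  "convex_body S \<longleftrightarrow> compact S \<and> convex S"

definition SO :: "(real ^ 'n ^ 'n) set" where
  "SO = {A. rotation_matrix A}"

definition placed_copy :: "real ^ 'n ^ 'n \<Rightarrow> real ^ 'n \<Rightarrow> (real ^ 'n) set \<Rightarrow> (real ^ 'n) set" where
  "placed_copy \<rho> w S = (\<lambda>x. \<rho> *v x + w) ` S"

definition kakeya :: "(real ^ 'n) set \<Rightarrow> (real ^ 'n) set \<Rightarrow> bool" where
  "kakeya S K \<longleftrightarrow> (\<forall>\<rho>\<in>SO. \<exists>w. placed_copy \<rho> w S \<subseteq> K)"

end

theory Submission
  imports Defs
begin

text \<open>
  Write \<open>\<real>\<^sup>4 = \<real>\<^sup>2 \<times> \<real>\<^sup>2\<close> with coordinates \<open>(1, 2)\<close> and \<open>(3, 4)\<close>, let \<open>u\<close> range over the vertices of an equilateral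
  triangle inscribed in the unit circle of the first plane (the \<open>contacts\<close>), and let \<open>turn u\<close> be
  the unit tangent of that circle at \<open>u\<close>.

  The body \<open>shape\<close> lies in the unit ball and meets the unit sphere only in the three contacts. Near
  \<open>u\<close> it is the convex hull of a double cone, cut out of a sphere of radius \<open>\<kappa> < 1\<close> tangent to the
  unit sphere at \<open>u\<close>: the points that deviate from \<open>u\<close> at least as much in the second plane as in the
  direction \<open>turn u\<close>. So its shadow in the first plane has radius of curvature \<open>\<kappa> / 2\<close> at \<open>u\<close>, although
  that of the body in the directions of the second plane is \<open>\<kappa>\<close>. The copy in standard orientation fits into a prism over this
  shadow and can slide in the direction of the fourth axis \<open>e4\<close>, but a small rotation of size \<open>r\<close>
  spoils this: the shadow grows, at distance about \<open>r\<close> from a contact, by about \<open>r\<^sup>2\<close>.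

  The body \<open>room\<close> is cut out of a ball by half-spaces, two for every contact \<open>u\<close> and every
  \<open>level n = 10^(-5(n+1))\<close>. With \<open>Y = level n\<close> their normals are \<open>u \<plusminus> Y turn u\<close>, up to a term of order \<open>Y\<^sup>2\<close>
  in the direction \<open>e4\<close>. In terms of the depth below the tangent plane at \<open>u\<close> and the tangential
  coordinate \<open>y\<close>, they say \<open>depth \<ge> Y \<bar>y\<bar> - \<beta> Y\<^sup>2 / 2\<close>, where \<open>\<beta>\<close> depends linearly on the fourth coordinate,
  between \<open>11/20\<close> (just more than the radius of curvature of the shadow) and \<open>41/40\<close> (just more than that
  of the unit sphere). The larger value is attained at \<open>x\<^sub>4 = side n = (-1)^n\<close>. Hence the wide end of
  \<open>room\<close> alternates from level to level.

  Every orientation fits (\<open>kakeya_shape_room\<close>). If the orientation is at distance \<open>r\<close> from the symmetries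
  of the triangle, only the levels between \<open>r / 100\<close> and \<open>1000 r\<close> are critical, there is at most one of
  them, and the copy is put at its wide end. For much larger levels the copy looks unrotated; for much
  smaller levels the contacts that moved have left the sphere by an amount of order \<open>r\<^sup>2\<close>, and a
  translation by a multiple of \<open>r\<^sup>2\<close> in the first plane shares this slack with the contacts that did not
  move. This sharing is possible because the three contacts have only one linear dependency.

  Conversely, let \<open>deviation\<close> measure the distance of an orientation from the standard one, up to
  rotations of the second plane. If it equals
  \<open>level n\<close>, the sum of three of the half-space conditions, one for each contact, does not
  involve the translation in the first plane, and it forces \<open>side n * w\<^sub>4 \<ge> 1/20\<close> for the translation \<open>w\<close>
  (\<open>blocking\<close>). A motion that leaves the standard orientation for the last time at time \<open>t\<^sub>0\<close> runs through
  all small deviations right after \<open>t\<^sub>0\<close>, so \<open>w\<^sub>4\<close> oscillates between \<open>\<ge> 1/20\<close> and \<open>\<le> -1/20\<close> as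
  \<open>t\<close> tends to \<open>t\<^sub>0\<close>, and the motion cannot be continuous (\<open>no_path\<close>).

  The numerical constants are not optimal. What matters is that \<open>(11/20 + 41/40) / 2 = 63/80\<close>, the value
  of \<open>\<beta>\<close> at fourth coordinate \<open>0\<close>, is smaller than the value needed in \<open>blocking\<close>.
\<close>

section \<open>Three contact points in a coordinate plane\<close>

text \<open>Vectors of the first coordinate plane.\<close>

definition plane_vec :: "real \<Rightarrow> real \<Rightarrow> real ^ 4" where
  "plane_vec a b = vector [a, b, 0, 0]"

text \<open>The vertices of the triangle; they sum to zero.\<close>

definition contacts :: "(real ^ 4) set" where
  "contacts = {plane_vec 1 0, plane_vec (-1/2) (sqrt 3 / 2), plane_vec (-1/2) (- sqrt 3 / 2)}"

text \<open>Orthogonal projection to the first plane, followed by the rotation by a right angle.\<close>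

definition turn :: "real ^ 4 \<Rightarrow> real ^ 4" where
  "turn v = plane_vec (- v $ 2) (v $ 1)"

text \<open>Orthogonal projection to the second coordinate plane.\<close>

definition perp :: "real ^ 4 \<Rightarrow> real ^ 4" where
  "perp v = vector [0, 0, v $ 3, v $ 4]"

abbreviation e4 :: "real ^ 4" where "e4 \<equiv> axis 4 1"

lemma vector_4_nth [simp]:
  "(vector [a, b, c, d] :: 'a::zero ^ 4) $ 1 = a"
  "(vector [a, b, c, d] :: 'a::zero ^ 4) $ 2 = b"
  "(vector [a, b, c, d] :: 'a::zero ^ 4) $ 3 = c"
  "(vector [a, b, c, d] :: 'a::zero ^ 4) $ 4 = d"
  by (simp_all add: vector_def)

lemma inner_4: "(x::real^4) \<bullet> y = x$1 * y$1 + x$2 * y$2 + x$3 * y$3 + x$4 * y$4"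
  by (simp add: inner_vec_def sum_4)

lemma plane_vec_nth [simp]:
  "plane_vec a b $ 1 = a" "plane_vec a b $ 2 = b" "plane_vec a b $ 3 = 0" "plane_vec a b $ 4 = 0"
  by (simp_all add: plane_vec_def)

lemma turn_nth [simp]:
  "turn v $ 1 = - v $ 2" "turn v $ 2 = v $ 1" "turn v $ 3 = 0" "turn v $ 4 = 0"
  by (simp_all add: turn_def)

lemma perp_nth [simp]:
  "perp v $ 1 = 0" "perp v $ 2 = 0" "perp v $ 3 = v $ 3" "perp v $ 4 = v $ 4"
  by (simp_all add: perp_def)

lemma e4_nth [simp]: "e4 $ 1 = 0" "e4 $ 2 = 0" "e4 $ 3 = 0" "e4 $ 4 = 1"
  by (simp_all add: axis_def)

lemma finite_contacts [simp]: "finite contacts" "contacts \<noteq> {}"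
  by (simp_all add: contacts_def)

lemma contact_facts:
  assumes "u \<in> contacts"
  shows "u $ 3 = 0" "u $ 4 = 0" "u $ 1 * u $ 1 + u $ 2 * u $ 2 = 1"
  using assms by (auto simp: contacts_def)

lemma contact_inner:
  assumes "u \<in> contacts"
  shows "u \<bullet> u = 1" "turn u \<bullet> turn u = 1" "u \<bullet> turn u = 0" "turn u \<bullet> u = 0" "norm u = 1" "norm (turn u) = 1"
    "u \<bullet> e4 = 0" "turn u \<bullet> e4 = 0" "perp u = 0"
  using contact_facts[OF assms] by (auto simp: inner_4 norm_eq_1 algebra_simps vec_eq_iff forall_4)

lemma contact_distinct_inner:
  assumes "u \<in> contacts" "k \<in> contacts" "u \<noteq> k"
  shows "u \<bullet> k = - (1/2)"
  using assms by (auto simp: contacts_def inner_4 power2_eq_square field_simps)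

lemma linear_perp: "linear perp"
  by (rule linearI) (auto simp: vec_eq_iff forall_4)

lemma inner_contact_decomp:
  assumes "u \<in> contacts"
  shows "q \<bullet> v = (u \<bullet> q) * (u \<bullet> v) + (turn u \<bullet> q) * (turn u \<bullet> v) + perp q \<bullet> perp v"
  using contact_facts[OF assms]
  apply (simp add: inner_4)
  apply algebra
  done

lemma norm_perp_le: "norm (perp v) \<le> norm v"
  by (simp add: norm_le inner_4)

section \<open>The two bodies\<close>

text \<open>
  The radius of the small spheres from which \<open>shape\<close> is made. It must be less than \<open>1\<close>, to give
  slack to the contacts that are rotated away, and close to \<open>1\<close> for the blocking estimate.
\<close>

definition \<kappa> :: real where "\<kappa> = 99/100"

text \<open>
  For each contact \<open>u\<close>, the sphere of radius \<open>\<kappa>\<close> that touches the unit sphere at \<open>u\<close> from inside, restricted to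
  the directions \<open>q\<close> whose component along \<open>turn u\<close> is dominated by the component in the second plane.
\<close>

definition shape_points :: "(real ^ 4) set" where
  "shape_points = {(1 - \<kappa>) *\<^sub>R u + \<kappa> *\<^sub>R q | u q. u \<in> contacts \<and> norm q = 1 \<and> \<bar>turn u \<bullet> q\<bar> \<le> norm (perp q)}"

definition shape :: "(real ^ 4) set" where
  "shape = closure (convex hull shape_points)"

text \<open>
  The normals of the half-spaces that bound \<open>room\<close>; here \<open>e\<close> and \<open>s\<close> are signs and \<open>Y\<close> is the scale. The
  coefficient \<open>19/160\<close> gives the total variation \<open>19/40 = 41/40 - 11/20\<close> of \<open>\<beta>\<close> between \<open>x\<^sub>4 = -1\<close> and \<open>x\<^sub>4 = 1\<close>.
\<close>

definition normal :: "real ^ 4 \<Rightarrow> real \<Rightarrow> real \<Rightarrow> real \<Rightarrow> real ^ 4" where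
  "normal u e s Y = u + (e * Y) *\<^sub>R turn u - (19/160 * s * Y\<^sup>2) *\<^sub>R e4"

text \<open>The scales of the half-spaces, and the alternating sides at which \<open>room\<close> is wide.\<close>

definition level :: "nat \<Rightarrow> real" where "level n = (1/100000) ^ Suc n"

definition side :: "nat \<Rightarrow> real" where "side n = (-1) ^ n"

text \<open>The radius \<open>10\<close> is immaterial; it makes \<open>room\<close> bounded.\<close>

definition room :: "(real ^ 4) set" where
  "room = {z. norm z \<le> 10 \<and> (\<forall>u\<in>contacts. \<forall>e\<in>{-1,1}. \<forall>n.
      normal u e (side n) (level n) \<bullet> z \<le> 1 + 63/160 * (level n)\<^sup>2)}"

section \<open>Support estimates for rotated copies\<close>

text \<open>
  In the following \<open>L\<close> is the inverse of the rotation of a copy, so that the rotated copy of \<open>a\<close> has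
  inner product \<open>a \<bullet> L n\<close> with the normal \<open>n\<close>. A normal is a contact plus \<open>Y\<close> times an almost unit
  vector orthogonal to it.
\<close>

definition tilt :: "real ^ 4 \<Rightarrow> real \<Rightarrow> real \<Rightarrow> real \<Rightarrow> real ^ 4" where
  "tilt u e s Y = e *\<^sub>R turn u - (19/160 * s * Y) *\<^sub>R e4"

lemma normal_tilt: "normal u e s Y = u + Y *\<^sub>R tilt u e s Y"
  by (simp add: normal_def tilt_def algebra_simps power2_eq_square)

lemma tilt_facts:
  assumes "u \<in> contacts" "e\<^sup>2 = 1" "s\<^sup>2 = 1" "0 < Y" "Y \<le> 1/100000"
  shows "u \<bullet> tilt u e s Y = 0" "tilt u e s Y \<bullet> tilt u e s Y = 1 + (19/160 * Y)\<^sup>2"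
    "norm (tilt u e s Y) \<le> (1001/1000)"
proof -
  have e4: "e4 \<bullet> e4 = 1" "e4 \<bullet> turn u = 0"
    by (simp_all add: inner_4)
  show "u \<bullet> tilt u e s Y = 0"
    using contact_inner[OF assms(1)] by (simp add: tilt_def inner_diff_right)
  show t: "tilt u e s Y \<bullet> tilt u e s Y = 1 + (19/160 * Y)\<^sup>2"
    using contact_inner[OF assms(1)] e4 assms(2,3)
    by (simp add: tilt_def inner_diff_right inner_diff_left power2_eq_square algebra_simps)
  have "Y\<^sup>2 \<le> 1" using assms by (simp add: power_le_one)
  hence "(norm (tilt u e s Y))\<^sup>2 \<le> 1 + (19/160)^2 * Y\<^sup>2"
    unfolding power2_norm_eq_inner t by (simp add: power2_eq_square)
  moreover have "Y\<^sup>2 \<le> 1/100000"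
    using mult_mono[of Y "1/100000" Y 1] assms by (simp add: power2_eq_square)
  ultimately have "(norm (tilt u e s Y))\<^sup>2 \<le> (1001/1000)\<^sup>2"
    by (simp add: power2_eq_square)
  thus "norm (tilt u e s Y) \<le> (1001/1000)" by (rule power2_le_imp_le) simp
qed

lemma norm_normal_le:
  assumes "u \<in> contacts" "e\<^sup>2 = 1" "s\<^sup>2 = 1" "0 < Y" "Y \<le> 1/100000"
  shows "norm (normal u e s Y) \<le> 1 + (5001/10000) * Y\<^sup>2"
proof (rule power2_le_imp_le)
  note t = tilt_facts[OF assms]
  have Y: "Y\<^sup>2 \<le> 1/100000"
    using mult_mono[of Y "1/100000" Y 1] assms by (simp add: power2_eq_square)
  have "(norm (normal u e s Y))\<^sup>2 = 1 + Y\<^sup>2 * (1 + (19/160)\<^sup>2 * Y\<^sup>2)"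
    unfolding power2_norm_eq_inner normal_tilt using t(1,2) contact_inner[OF assms(1)]
    by (simp add: inner_add_left inner_add_right inner_commute power2_eq_square algebra_simps)
  also have "\<dots> \<le> 1 + Y\<^sup>2 * (1 + (2/10000))"
    using Y by (intro add_left_mono mult_left_mono) (auto simp: power2_eq_square)
  also have "\<dots> \<le> (1 + (5001/10000) * Y\<^sup>2)\<^sup>2"
    using zero_le_power[of Y 4] assms(4) by (simp add: power2_eq_square power4_eq_xxxx algebra_simps)
  finally show "(norm (normal u e s Y))\<^sup>2 \<le> (1 + (5001/10000) * Y\<^sup>2)\<^sup>2" .
qed auto

lemma shape_pointsE:
  assumes "a \<in> shape_points"
  obtains k q where "k \<in> contacts" "norm q = 1" "\<bar>turn k \<bullet> q\<bar> \<le> norm (perp q)" "a = (1 - \<kappa>) *\<^sub>R k + \<kappa> *\<^sub>R q"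
  using assms by (auto simp: shape_points_def)

lemma shape_point_inner_le:
  assumes "k \<in> contacts" "norm q = 1" "a = (1 - \<kappa>) *\<^sub>R k + \<kappa> *\<^sub>R q"
  shows "a \<bullet> v \<le> (1 - \<kappa>) * (k \<bullet> v) + \<kappa> * norm v"
  using norm_cauchy_schwarz[of q v] assms(2)
  by (simp add: assms(3) inner_add_left \<kappa>_def)

lemma shape_point_norm_le:
  assumes "a \<in> shape_points"
  shows "norm a \<le> 1"
proof -
  obtain k q where "k \<in> contacts" "norm q = 1" and a: "a = (1 - \<kappa>) *\<^sub>R k + \<kappa> *\<^sub>R q"
    using shape_pointsE[OF assms] by metis
  thus ?thesis using norm_triangle_ineq[of "(1 - \<kappa>) *\<^sub>R k" "\<kappa> *\<^sub>R q"] contact_inner(5)[of k]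
    by (simp add: \<kappa>_def)
qed

text \<open>
  The first-order effect of \<open>Y\<close> is bounded by the distance of \<open>L u\<close> from \<open>k\<close>, because \<open>tilt\<close> is orthogonal to \<open>u\<close>.
\<close>

lemma contact_inner_normal_le:
  assumes L: "orthogonal_transformation L"
    and k: "k \<in> contacts"
    and u: "u \<in> contacts" "e\<^sup>2 = 1" "s\<^sup>2 = 1" "0 < Y" "Y \<le> 1/100000"
  shows "k \<bullet> L (normal u e s Y) \<le> 1 - (norm (L u - k))\<^sup>2 / 2 + (1001/1000) * Y * norm (L u - k)"
    and "k \<bullet> L (normal u e s Y) \<ge> 1 - (norm (L u - k))\<^sup>2 / 2 - (1001/1000) * Y * norm (L u - k)"
proof -
  let ?t = "tilt u e s Y"
  have lin: "linear L" and LL: "\<And>x y. L x \<bullet> L y = x \<bullet> y"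
    using L by (auto simp: orthogonal_transformation_def)
  have n: "L (normal u e s Y) = L u + Y *\<^sub>R L ?t"
    by (simp add: normal_tilt linear_add[OF lin] linear_scale[OF lin])
  have ku: "k \<bullet> L u = 1 - (norm (L u - k))\<^sup>2 / 2"
    unfolding power2_norm_eq_inner using contact_inner[OF k] contact_inner[OF u(1)]
    by (simp add: inner_diff_left inner_diff_right LL inner_commute field_simps)
  have "\<bar>(L u - k) \<bullet> L ?t\<bar> \<le> norm (L u - k) * norm (L ?t)"
    by (rule Cauchy_Schwarz_ineq2)
  also have "norm (L ?t) = norm ?t" using L by (rule orthogonal_transformation_norm)
  also have "norm (L u - k) * norm ?t \<le> norm (L u - k) * (1001/1000)"
    using tilt_facts[OF u] by (intro mult_left_mono) auto
  finally have "\<bar>k \<bullet> L ?t\<bar> \<le> (1001/1000) * norm (L u - k)"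
    using tilt_facts[OF u] by (simp add: inner_diff_left LL)
  hence "\<bar>Y * (k \<bullet> L ?t)\<bar> \<le> Y * ((1001/1000) * norm (L u - k))"
    unfolding abs_mult using u by (intro mult_mono) auto
  thus "k \<bullet> L (normal u e s Y) \<le> 1 - (norm (L u - k))\<^sup>2 / 2 + (1001/1000) * Y * norm (L u - k)"
   "k \<bullet> L (normal u e s Y) \<ge> 1 - (norm (L u - k))\<^sup>2 / 2 - (1001/1000) * Y * norm (L u - k)"
    unfolding n inner_add_right ku inner_scaleR_right by (auto simp: abs_le_iff algebra_simps)
qed

text \<open>The bound that comes from the unit ball alone, and holds for all orientations.\<close>

lemma shape_any_estimate:
  assumes L: "orthogonal_transformation L"
    and u: "u \<in> contacts" "e\<^sup>2 = 1" "s\<^sup>2 = 1" "0 < Y" "Y \<le> 1/100000"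
    and a: "a \<in> shape_points"
  shows "a \<bullet> L (normal u e s Y) \<le> 1 + (5001/10000) * Y\<^sup>2"
proof -
  have "a \<bullet> L (normal u e s Y) \<le> norm a * norm (L (normal u e s Y))"
    by (rule norm_cauchy_schwarz)
  also have "\<dots> \<le> 1 * norm (normal u e s Y)"
    using shape_point_norm_le[OF a] orthogonal_transformation_norm[OF L]
    by (intro mult_mono) auto
  finally show ?thesis using norm_normal_le[OF u] by simp
qed

text \<open>
  If the rotation moves \<open>u\<close> away from the contact \<open>k\<close> by more than the scale \<open>Y\<close>, then the points near \<open>k\<close>
  have left the sphere by an amount quadratic in the distance, since \<open>\<kappa> < 1\<close>.
\<close>

lemma shape_far_estimate:
  assumes L: "orthogonal_transformation L"
    and u: "u \<in> contacts" "e\<^sup>2 = 1" "s\<^sup>2 = 1" "0 < Y" "Y \<le> 1/100000"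
    and a: "norm q = 1" "a = (1 - \<kappa>) *\<^sub>R k + \<kappa> *\<^sub>R q" and k: "k \<in> contacts"
    and d: "4 * Y \<le> norm (L u - k)"
  shows "a \<bullet> L (normal u e s Y) \<le> 1 - (24/10000) * (norm (L u - k))\<^sup>2 + (4952/10000) * Y\<^sup>2"
proof -
  define D where "D = norm (L u - k)"
  have "4 * Y * D \<le> D * D" using d by (intro mult_right_mono) (auto simp: D_def)
  moreover have "k \<bullet> L (normal u e s Y) \<le> 1 - D * D / 2 + 1001/1000 * (Y * D)"
    using contact_inner_normal_le(1)[OF L k u] by (simp add: D_def[symmetric] power2_eq_square mult.assoc)
  ultimately have "k \<bullet> L (normal u e s Y) \<le> 1 - (24/100) * D\<^sup>2"
    using zero_le_square[of D] unfolding power2_eq_square by linarith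
  moreover have "norm (L (normal u e s Y)) \<le> 1 + (5001/10000) * Y\<^sup>2"
    using norm_normal_le[OF u] orthogonal_transformation_norm[OF L] by simp
  ultimately have "a \<bullet> L (normal u e s Y) \<le> (1 - \<kappa>) * (1 - (24/100) * D\<^sup>2) + \<kappa> * (1 + (5001/10000) * Y\<^sup>2)"
    by (intro order.trans[OF shape_point_inner_le[OF k a]] add_mono mult_left_mono) (auto simp: \<kappa>_def)
  also have "\<dots> \<le> 1 - (24/10000) * D\<^sup>2 + (4952/10000) * Y\<^sup>2"
    using zero_le_power2[of Y] by (simp add: \<kappa>_def algebra_simps)
  finally show ?thesis by (simp add: D_def)
qed

text \<open>
  The support function of the double cone of directions \<open>q\<close>: since at most half of the squared deviation of
  \<open>q\<close> from \<open>k\<close> can be in the direction \<open>turn k\<close>, the component of \<open>v\<close> along \<open>turn k\<close> only counts with the factor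
  \<open>1 / sqrt 2 < 0.7072\<close>.
\<close>

lemma sector_inner_le:
  assumes k: "k \<in> contacts" and q: "norm q = 1" "\<bar>turn k \<bullet> q\<bar> \<le> norm (perp q)"
    and c: "0 < c" "k \<bullet> v = c" and b: "\<bar>turn k \<bullet> v\<bar> \<le> b" and g: "norm (perp v) \<le> g"
  shows "q \<bullet> v \<le> c + ((7072/10000) * b + g)\<^sup>2 / (2 * c)"
proof -
  define x where "x = norm (perp q)"
  define y where "y = \<bar>turn k \<bullet> q\<bar>"
  define h where "h = sqrt (y\<^sup>2 + x\<^sup>2)"
  define z where "z = (7072/10000) * b + g"
  have yx: "0 \<le> y" "y \<le> x" using q by (auto simp: x_def y_def)
  have h2: "h\<^sup>2 = y\<^sup>2 + x\<^sup>2" and h0: "0 \<le> h" by (simp_all add: h_def)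
  have one: "(k \<bullet> q)\<^sup>2 + h\<^sup>2 = 1"
    using inner_contact_decomp[OF k, of q q] q(1) unfolding h2 x_def y_def power2_norm_eq_inner
    by (simp add: norm_eq_1 power2_eq_square)
  have y: "y \<le> (7072/10000) * h"
  proof (rule power2_le_imp_le)
    have "y\<^sup>2 \<le> x\<^sup>2" using yx by (intro power_mono) auto
    thus "y\<^sup>2 \<le> ((7072/10000) * h)\<^sup>2" unfolding power_mult_distrib h2 
      by (simp add: power2_eq_square) (smt (verit) zero_le_square)
  qed (use h0 in auto)
  have x: "x \<le> h" unfolding h_def by (rule real_le_rsqrt) simp
  have "k \<bullet> q \<le> 1 - h\<^sup>2 / 2"
  proof -
    have "0 \<le> (k \<bullet> q - 1)\<^sup>2" by simp
    thus ?thesis using one by (simp add: power2_eq_square algebra_simps)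
  qed
  hence 1: "(k \<bullet> q) * c \<le> (1 - h\<^sup>2 / 2) * c" using c by (intro mult_right_mono) auto
  have "(turn k \<bullet> q) * (turn k \<bullet> v) \<le> \<bar>turn k \<bullet> q\<bar> * \<bar>turn k \<bullet> v\<bar>"
    by (metis abs_ge_self abs_mult)
  also have "\<dots> \<le> ((7072/10000) * h) * b"
    using b y h0 unfolding y_def by (intro mult_mono) auto
  finally have 2: "(turn k \<bullet> q) * (turn k \<bullet> v) \<le> (7072/10000) * h * b" .
  have "perp q \<bullet> perp v \<le> norm (perp q) * norm (perp v)" by (rule norm_cauchy_schwarz)
  also have "\<dots> \<le> h * g" using x g h0 unfolding x_def by (intro mult_mono) auto
  finally have 3: "perp q \<bullet> perp v \<le> h * g" .
  have "q \<bullet> v \<le> c - h\<^sup>2 * c / 2 + h * z"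
    using inner_contact_decomp[OF k, of q v] 1 2 3 c by (simp add: z_def algebra_simps)
  also have "\<dots> \<le> c + z\<^sup>2 / (2 * c)"
  proof -
    \<comment> \<open>maximise over \<open>h\<close>, the maximum being at \<open>h = z / c\<close>\<close>
    have "0 \<le> (h * c - z)\<^sup>2" by simp
    hence "2 * c * (h * z) - (h * c)\<^sup>2 \<le> z\<^sup>2" by (simp add: power2_eq_square algebra_simps)
    thus ?thesis using c(1) by (simp add: field_simps power2_eq_square)
  qed
  finally show ?thesis by (simp add: z_def)
qed

lemma turn_contact:
  assumes "u \<in> contacts"
  obtains k l where "k \<in> contacts" "l \<in> contacts" "turn u = (1 / sqrt 3) *\<^sub>R (k - l)"
proof -
  have 0: "turn (plane_vec 1 0) = (1 / sqrt 3) *\<^sub>R (plane_vec (-1/2) (sqrt 3 / 2) - plane_vec (-1/2) (- sqrt 3 / 2))"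
    and 1: "turn (plane_vec (-1/2) (sqrt 3 / 2)) = (1 / sqrt 3) *\<^sub>R (plane_vec (-1/2) (- sqrt 3 / 2) - plane_vec 1 0)"
    and 2: "turn (plane_vec (-1/2) (- sqrt 3 / 2)) = (1 / sqrt 3) *\<^sub>R (plane_vec 1 0 - plane_vec (-1/2) (sqrt 3 / 2))"
    by (auto simp: vec_eq_iff forall_4 field_simps)
  thus ?thesis using assms that unfolding contacts_def by fastforce
qed

text \<open>
  The tangent at one contact is a multiple of the difference of the other two, so it nearly stays in
  the first plane if the contacts do.
\<close>

lemma perp_turn_le:
  assumes lin: "linear L" and u: "u \<in> contacts"
    and r: "\<And>k. k \<in> contacts \<Longrightarrow> norm (perp (L k)) \<le> r"
  shows "norm (perp (L (turn u))) \<le> 2 * r"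
proof -
  obtain k l where kl: "k \<in> contacts" "l \<in> contacts" "turn u = (1 / sqrt 3) *\<^sub>R (k - l)"
    using turn_contact[OF u] .
  have "perp (L (turn u)) = (1 / sqrt 3) *\<^sub>R (perp (L k) - perp (L l))"
    by (simp add: kl linear_diff[OF lin] linear_scale[OF lin] linear_diff[OF linear_perp] linear_scale[OF linear_perp])
  hence "norm (perp (L (turn u))) = (1 / sqrt 3) * norm (perp (L k) - perp (L l))"
    by simp
  also have "\<dots> \<le> 1 * (r + r)"
    using norm_triangle_ineq4[of "perp (L k)" "perp (L l)"] r[OF kl(1)] r[OF kl(2)]
    by (intro mult_mono) auto
  finally show ?thesis by simp
qed

lemma contact_distinct_norm:
  assumes "u \<in> contacts" "k \<in> contacts" "u \<noteq> k"
  shows "(17/10) \<le> norm (u - k)"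
proof (rule power2_le_imp_le)
  have "(norm (u - k))\<^sup>2 = 3"
    unfolding power2_norm_eq_inner
    using contact_distinct_inner[OF assms] contact_inner[OF assms(1)] contact_inner[OF assms(2)]
    by (simp add: inner_diff_left inner_diff_right inner_commute)
  thus "(17/10)\<^sup>2 \<le> (norm (u - k))\<^sup>2" by (simp add: power2_eq_square)
qed auto

text \<open>
  A rotation that is small compared to \<open>Y\<close>, up to a symmetry of the triangle, does not increase the support
  function much beyond the value \<open>1 + Y\<^sup>2 / 4\<close>, which is given by the curvature of the shadow.
\<close>

lemma shape_near_estimate:
  assumes L: "orthogonal_transformation L"
    and u: "u \<in> contacts" "e\<^sup>2 = 1" "s\<^sup>2 = 1" "0 < Y" "Y \<le> 1/100000"
    and a: "a \<in> shape_points"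
    and r: "\<And>k. k \<in> contacts \<Longrightarrow> \<exists>l\<in>contacts. norm (L k - l) \<le> r" "1000 * r \<le> Y"
  shows "a \<bullet> L (normal u e s Y) \<le> 1 + (257/1000) * Y\<^sup>2"
proof -
  let ?v = "L (normal u e s Y)" and ?t = "tilt u e s Y"
  have lin: "linear L" and LL: "\<And>x y. L x \<bullet> L y = x \<bullet> y"
    using L by (auto simp: orthogonal_transformation_def)
  obtain k q where k: "k \<in> contacts" and q: "norm q = 1" "\<bar>turn k \<bullet> q\<bar> \<le> norm (perp q)"
    and ak: "a = (1 - \<kappa>) *\<^sub>R k + \<kappa> *\<^sub>R q"
    using a by (rule shape_pointsE)
  obtain l where l: "l \<in> contacts" "norm (L u - l) \<le> r" using r(1)[OF u(1)] by blast
  have r0: "0 \<le> r" using l(2) norm_ge_zero order.trans by blast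
  define D where "D = norm (L u - k)"
  show ?thesis
  proof (cases "k = l")
    case False
    have "(17/10) \<le> norm (l - k)" using contact_distinct_norm[OF l(1) k] False by simp
    also have "\<dots> \<le> norm (L u - k) + norm (L u - l)" 
      using norm_triangle_ineq4[of "L u - k" "L u - l"] by simp
    finally have D: "1 \<le> D" using l r u by (simp add: D_def)
    hence "4 * Y \<le> norm (L u - k)" using u by (simp add: D_def)
    note shape_far_estimate[OF L u q(1) ak k this]
    moreover have "1 \<le> D\<^sup>2" using D by simp
    moreover have "Y\<^sup>2 \<le> 1/100000"
      using mult_mono[of Y "1/100000" Y 1] u by (simp add: power2_eq_square)
    ultimately show ?thesis using zero_le_power2[of Y] unfolding D_def[symmetric] by linarith
  next
    case True
    hence Dr: "D \<le> r" and D0: "0 \<le> D" using l by (auto simp: D_def)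
    have v: "?v = L u + Y *\<^sub>R L ?t"
      by (simp add: normal_tilt linear_add[OF lin] linear_scale[OF lin])
    have nt: "norm (L ?t) \<le> (1001/1000)"
      using tilt_facts(3)[OF u] orthogonal_transformation_norm[OF L] by simp
    define c where "c = k \<bullet> ?v"
    have YD: "Y * D \<le> Y * (Y / 1000)" using Dr r u by (intro mult_left_mono) auto
    have D1: "D \<le> 1/100000" using Dr r u by simp
    have D2: "D\<^sup>2 \<le> 1/100000" using D1 D0 mult_mono[of D "1/100000" D 1] by (simp add: power2_eq_square)
    have Y2: "Y\<^sup>2 \<le> 1/100000"
      using mult_mono[of Y "1/100000" Y 1] u by (simp add: power2_eq_square)
    have "c \<le> 1 - D * D / 2 + 1001/1000 * (Y * D)" "c \<ge> 1 - D * D / 2 - 1001/1000 * (Y * D)"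
      using contact_inner_normal_le[OF L k u] by (simp_all add: c_def D_def[symmetric] power2_eq_square mult.assoc)
    hence c1: "c \<le> 1 + (11/10000) * Y\<^sup>2" "(99/100) \<le> c"
      using YD D2 Y2 zero_le_square[of D] unfolding power2_eq_square by linarith+
    have b: "\<bar>turn k \<bullet> ?v\<bar> \<le> (1002/1000) * Y"
    proof -
      have "turn k \<bullet> L u = turn k \<bullet> (L u - k)"
        using contact_inner[OF k] by (simp add: inner_diff_right)
      hence 1: "\<bar>turn k \<bullet> L u\<bar> \<le> D"
        using Cauchy_Schwarz_ineq2[of "turn k" "L u - k"] contact_inner[OF k] by (simp add: D_def)
      have "\<bar>turn k \<bullet> L ?t\<bar> \<le> (1001/1000)"
        using Cauchy_Schwarz_ineq2[of "turn k" "L ?t"] contact_inner[OF k] nt by simp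
      hence "\<bar>Y * (turn k \<bullet> L ?t)\<bar> \<le> Y * (1001/1000)"
        unfolding abs_mult using u by (intro mult_mono) auto
      thus ?thesis using 1 Dr r unfolding v inner_add_right inner_scaleR_right by linarith
    qed
    have pr: "norm (perp (L j)) \<le> r" if j: "j \<in> contacts" for j
    proof -
      obtain m where m: "m \<in> contacts" "norm (L j - m) \<le> r" using r(1)[OF j] by blast
      have "perp (L j) = perp (L j - m)"
        using contact_inner(9)[OF m(1)] by (simp add: linear_diff[OF linear_perp])
      thus ?thesis using norm_perp_le[of "L j - m"] m by simp
    qed
    have g: "norm (perp ?v) \<le> (11/10000) * Y"
    proof -
      have "perp ?v = perp (L u) + (Y * e) *\<^sub>R perp (L (turn u)) - (19/160 * s * Y\<^sup>2) *\<^sub>R perp (L e4)"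
        unfolding normal_def by (simp add: linear_add[OF lin] linear_diff[OF lin] linear_scale[OF lin]
          linear_add[OF linear_perp] linear_diff[OF linear_perp] linear_scale[OF linear_perp] mult.commute)
      hence "norm (perp ?v) \<le> norm (perp (L u)) + norm ((Y * e) *\<^sub>R perp (L (turn u)))
          + norm ((19/160 * s * Y\<^sup>2) *\<^sub>R perp (L e4))"
        by (simp only:) (intro norm_triangle_le_diff add_mono norm_triangle_ineq order_refl)
      also have "norm ((Y * e) *\<^sub>R perp (L (turn u))) \<le> Y * (2 * r)"
        using perp_turn_le[OF lin u(1) pr] u(2,4) by (auto simp: abs_mult power2_eq_1_iff intro!: mult_left_mono)
      also have "norm ((19/160 * s * Y\<^sup>2) *\<^sub>R perp (L e4)) \<le> 19/160 * Y\<^sup>2 * 1"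
      proof -
        have "norm (perp (L e4)) \<le> 1"
          using norm_perp_le[of "L e4"] orthogonal_transformation_norm[OF L, of e4] by simp
        thus ?thesis using u(3) by (auto simp: abs_mult power2_eq_1_iff mult_left_le)
      qed
      finally have "norm (perp ?v) \<le> r + Y * (2 * r) + 19/160 * Y\<^sup>2"
        using pr[OF u(1)] by simp
      moreover have "Y * (2 * r) \<le> 1/100000 * (2 * r)" using u r0 by (intro mult_right_mono) auto
      moreover have "Y * Y \<le> 1/100000 * Y" using u by (intro mult_right_mono) auto
      ultimately show ?thesis using r(2) u(4) unfolding power2_eq_square by linarith
    qed
    have "q \<bullet> ?v \<le> c + ((7072/10000) * ((1002/1000) * Y) + (11/10000) * Y)\<^sup>2 / (2 * c)"
      using c1 by (intro sector_inner_le[OF k q _ _ b g]) (auto simp: c_def)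
    also have "((7072/10000) * ((1002/1000) * Y) + (11/10000) * Y)\<^sup>2 / (2 * c) \<le> ((71/100) * Y)\<^sup>2 / (2 * (99/100))"
      using c1 u(4) by (intro frac_le power_mono) auto
    also have "((71/100) * Y)\<^sup>2 / (2 * (99/100)) = 5041/19800 * Y\<^sup>2"
      by (simp add: power2_eq_square)
    finally have "q \<bullet> ?v \<le> 1 + (2565/10000) * Y\<^sup>2"
      using c1(1) zero_le_power2[of Y] by linarith
    moreover have "a \<bullet> ?v = 1/100 * c + 99/100 * (q \<bullet> ?v)"
      by (simp add: ak inner_add_left c_def \<kappa>_def)
    ultimately show ?thesis
      using c1(1) zero_le_power2[of Y] by linarith
  qed
qed

section \<open>Every orientation fits\<close>

lemma level_facts: "0 < level n" "level n \<le> 1/100000"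
proof -
  show "0 < level n" by (simp add: level_def)
  have "(1/100000::real) ^ n \<le> 1" by (rule power_le_one) auto
  thus "level n \<le> 1/100000" by (simp add: level_def)
qed

lemma level_less:
  assumes "m < n"
  shows "100000 * level n \<le> level m"
proof -
  have "level n = (1/100000) ^ Suc m * (1/100000) ^ (n - m)"
    using assms by (simp add: level_def power_add[symmetric])
  also have "(1/100000::real) ^ (n - m) \<le> (1/100000) ^ 1"
    using assms by (intro power_decreasing) auto
  finally show ?thesis by (simp add: level_def)
qed

lemma side_sq: "(side n)\<^sup>2 = 1"
  by (simp add: side_def power2_eq_square flip: power_mult_distrib)

lemma normal_inner_contact_le:
  assumes u: "u \<in> contacts" "e\<^sup>2 = 1" "0 < Y" "Y \<le> 1/100000" and k: "k \<in> contacts" "k \<noteq> u"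
  shows "normal u e s Y \<bullet> k \<le> - (1/4)"
proof -
  have "\<bar>turn u \<bullet> k\<bar> \<le> 1"
    using Cauchy_Schwarz_ineq2[of "turn u" k] contact_inner[OF u(1)] contact_inner[OF k(1)] by simp
  hence "\<bar>e * Y * (turn u \<bullet> k)\<bar> \<le> 1/100000"
    using u mult_mono[of Y "1/100000" "\<bar>turn u \<bullet> k\<bar>" 1] by (auto simp: abs_mult power2_eq_1_iff)
  thus ?thesis
    using contact_distinct_inner[OF u(1) k(1)] k contact_inner(7)[OF k(1)]
    by (simp add: normal_def inner_add_left inner_diff_left inner_commute[of e4])
qed

text \<open>
  The translation \<open>\<Sum>k. (d k)\<^sup>2 k\<close> pushes contacts with large \<open>d\<close> outwards and relieves those with small \<open>d\<close>.
\<close>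

lemma drift_le:
  assumes u: "u \<in> contacts" "e\<^sup>2 = 1" "0 < Y" "Y \<le> 1/100000"
    and r: "r \<in> d ` contacts"
  shows "normal u e s Y \<bullet> (\<Sum>k\<in>contacts. (d k)\<^sup>2 *\<^sub>R k) \<le> 5/4 * (d u)\<^sup>2 - 1/4 * r\<^sup>2"
proof -
  have uu: "normal u e s Y \<bullet> u = 1"
    using contact_inner[OF u(1)] by (simp add: normal_def inner_add_left inner_diff_left inner_commute[of e4])
  obtain k where k: "k \<in> contacts" "r = d k" using r by auto
  have "normal u e s Y \<bullet> (\<Sum>k\<in>contacts. (d k)\<^sup>2 *\<^sub>R k) = (\<Sum>k\<in>contacts. (d k)\<^sup>2 * (normal u e s Y \<bullet> k))"
    by (simp add: inner_sum_right)
  also have "\<dots> = (d u)\<^sup>2 + (\<Sum>k\<in>contacts - {u}. (d k)\<^sup>2 * (normal u e s Y \<bullet> k))"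
    using u by (simp add: sum.remove uu)
  also have "(\<Sum>k\<in>contacts - {u}. (d k)\<^sup>2 * (normal u e s Y \<bullet> k)) \<le> (\<Sum>k\<in>contacts - {u}. - (1/4) * (d k)\<^sup>2)"
  proof (rule sum_mono)
    fix j assume "j \<in> contacts - {u}"
    hence "(d j)\<^sup>2 * (normal u e s Y \<bullet> j) \<le> (d j)\<^sup>2 * (- (1/4))"
      using normal_inner_contact_le[OF u, of j s] by (intro mult_left_mono) auto
    thus "(d j)\<^sup>2 * (normal u e s Y \<bullet> j) \<le> - (1/4) * (d j)\<^sup>2" by simp
  qed
  also have "\<dots> = - (1/4) * (\<Sum>k\<in>contacts - {u}. (d k)\<^sup>2)" by (simp add: sum_distrib_left)
  finally have *: "normal u e s Y \<bullet> (\<Sum>k\<in>contacts. (d k)\<^sup>2 *\<^sub>R k) \<le> (d u)\<^sup>2 - 1/4 * (\<Sum>k\<in>contacts - {u}. (d k)\<^sup>2)"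
    by simp
  show ?thesis
  proof (cases "k = u")
    case True
    have "0 \<le> (\<Sum>k\<in>contacts - {u}. (d k)\<^sup>2)" by (intro sum_nonneg) auto
    thus ?thesis using * True k by simp
  next
    case False
    have "r\<^sup>2 \<le> (\<Sum>k\<in>contacts - {u}. (d k)\<^sup>2)"
      using k False member_le_sum[of k "contacts - {u}" "\<lambda>k. (d k)\<^sup>2"] by simp
    thus ?thesis using * zero_le_power2[of "d u"] by linarith
  qed
qed

text \<open>
  One half-space condition for a copy translated by the drift and by \<open>x\<close> in the direction \<open>e4\<close>. Here \<open>d k\<close> is
  the distance of \<open>L k\<close> from the nearest contact. If \<open>Y\<close> is in the critical window around \<open>r\<close>, the copy has to
  be at the wide end \<open>x = s\<close>.
\<close>

lemma copy_fits:
  assumes L: "orthogonal_transformation L"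
    and u: "u \<in> contacts" "e\<^sup>2 = 1" "s\<^sup>2 = 1" "0 < Y" "Y \<le> 1/100000"
    and a: "a \<in> shape_points"
    and d: "d = (\<lambda>k. Min ((\<lambda>l. norm (L k - l)) ` contacts))" and r: "r = Max (d ` contacts)"
    and x: "x\<^sup>2 = 1" "r / 100 < Y \<Longrightarrow> Y < 1000 * r \<Longrightarrow> x = s"
  shows "a \<bullet> L (normal u e s Y) + 1/2000 * (normal u e s Y \<bullet> (\<Sum>k\<in>contacts. (d k)\<^sup>2 *\<^sub>R k))
     - 19/160 * s * x * Y\<^sup>2 \<le> 1 + 63/160 * Y\<^sup>2"
proof -
  define T where "T = a \<bullet> L (normal u e s Y)"
  define W where "W = normal u e s Y \<bullet> (\<Sum>k\<in>contacts. (d k)\<^sup>2 *\<^sub>R k)"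
  have W: "W \<le> 5/4 * (d u)\<^sup>2 - 1/4 * r\<^sup>2"
    unfolding W_def using u by (intro drift_le) (simp_all add: r)
  have d0: "0 \<le> d k" for k by (simp add: d)
  have dr: "d k \<le> r" if "k \<in> contacts" for k using that by (simp add: r)
  have r0: "0 \<le> r" using d0[of u] dr[OF u(1)] by linarith
  have dle: "d k \<le> norm (L k - l)" if "l \<in> contacts" for k l
    unfolding d using that by (intro Min_le) auto
  have dex: "\<exists>l\<in>contacts. norm (L k - l) \<le> r" if k: "k \<in> contacts" for k
  proof -
    have "d k \<in> (\<lambda>l. norm (L k - l)) ` contacts" unfolding d by (intro Min_in) auto
    then obtain l where "l \<in> contacts" "d k = norm (L k - l)" by blast
    thus ?thesis using dr[OF k] by metis
  qed
  have any: "T \<le> 1 + (5001/10000) * Y\<^sup>2"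
    unfolding T_def by (rule shape_any_estimate[OF L u a])
  have far: "T \<le> 1 - (24/10000) * (d u)\<^sup>2 + (4952/10000) * Y\<^sup>2" if "4 * Y \<le> d u"
  proof -
    obtain k q where k: "k \<in> contacts" and q: "norm q = 1" "a = (1 - \<kappa>) *\<^sub>R k + \<kappa> *\<^sub>R q"
      using a by (rule shape_pointsE)
    have "T \<le> 1 - (24/10000) * (norm (L u - k))\<^sup>2 + (4952/10000) * Y\<^sup>2"
      unfolding T_def using that dle[OF k, of u] by (intro shape_far_estimate[OF L u q k]) auto
    moreover have "(d u)\<^sup>2 \<le> (norm (L u - k))\<^sup>2"
      using d0 dle[OF k] by (intro power_mono) auto
    ultimately show ?thesis by linarith
  qed
  have near: "T \<le> 1 + (257/1000) * Y\<^sup>2" if "1000 * r \<le> Y"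
    unfolding T_def by (rule shape_near_estimate[OF L u a dex that])
  have far': "16 * Y\<^sup>2 \<le> (d u)\<^sup>2" if "4 * Y \<le> d u"
    using power_mono[OF that, of 2] u by (simp add: power_mult_distrib)
  have close: "(d u)\<^sup>2 \<le> 16 * Y\<^sup>2" if "d u \<le> 4 * Y"
    using power_mono[OF that d0, of 2] u by (simp add: power_mult_distrib)
  have Y0: "0 \<le> Y\<^sup>2" by simp
  have r2: "0 \<le> r\<^sup>2" by simp
  have du2: "0 \<le> (d u)\<^sup>2" by simp
  have "s = 1 \<or> s = -1" "x = 1 \<or> x = -1" using u(3) x(1) by (simp_all only: power2_eq_1_iff)
  hence "s * x = 1 \<or> s * x = -1" by auto
  hence "T + 1/2000 * W - 19/160 * (s * x) * Y\<^sup>2 \<le> 1 + 63/160 * Y\<^sup>2"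
  proof
    assume sx: "s * x = 1"
    show ?thesis
    proof (cases "4 * Y \<le> d u")
      case True
      thus ?thesis unfolding sx using far[OF True] far'[OF True] W r2 Y0 by linarith
    next
      case False
      hence "(d u)\<^sup>2 \<le> 16 * Y\<^sup>2" using close by simp
      thus ?thesis unfolding sx using any W r2 Y0 by linarith
    qed
  next
    assume sx: "s * x = -1"
    have "x \<noteq> s"
    proof
      assume "x = s"
      thus False using sx u(3) by (simp add: power2_eq_square)
    qed
    hence "1000 * r \<le> Y \<or> Y \<le> r / 100" using x(2) by linarith
    thus ?thesis
    proof
      assume Y: "1000 * r \<le> Y"
      have "d u \<le> Y" using dr[OF u(1)] r0 Y by linarith
      hence "(d u)\<^sup>2 \<le> Y\<^sup>2" using d0 by (intro power_mono) auto
      thus ?thesis unfolding sx using near[OF Y] W r2 Y0 by linarith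
    next
      assume Y: "Y \<le> r / 100"
      hence "(100 * Y)\<^sup>2 \<le> r\<^sup>2" using u by (intro power_mono) auto
      hence Yr: "10000 * Y\<^sup>2 \<le> r\<^sup>2" by (simp add: power_mult_distrib)
      show ?thesis
      proof (cases "20 * Y \<le> d u")
        case True
        have "400 * Y\<^sup>2 \<le> (d u)\<^sup>2" using power_mono[OF True, of 2] u by (simp add: power_mult_distrib)
        moreover have "4 * Y \<le> d u" using True u by linarith
        ultimately show ?thesis unfolding sx using far W r2 Y0 by linarith
      next
        case False
        hence "(d u)\<^sup>2 \<le> (20 * Y)\<^sup>2" using d0 by (intro power_mono) auto
        hence "(d u)\<^sup>2 \<le> 400 * Y\<^sup>2" by (simp add: power_mult_distrib)
        thus ?thesis unfolding sx using any W Yr Y0 by linarith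
      qed
    qed
  qed
  thus ?thesis unfolding T_def W_def by (simp only: mult.assoc)
qed

lemma room_closed_convex: "closed room" "convex room"
proof -
  have eq: "room = cball 0 10 \<inter> (\<Inter>u\<in>contacts. \<Inter>e\<in>{-1,1}. \<Inter>n. {z. normal u e (side n) (level n) \<bullet> z \<le> 1 + 63/160 * (level n)\<^sup>2})"
    by (auto simp: room_def)
  show "closed room" unfolding eq
    by (intro closed_Int closed_cball closed_INT ballI closed_halfspace_le)
  show "convex room" unfolding eq
    by (intro convex_Int convex_cball convex_INT convex_halfspace_le)
qed

lemma convex_body_room: "convex_body room"
proof -
  have "bounded room" by (rule bounded_subset[of "cball 0 10"]) (auto simp: room_def)
  thus ?thesis using room_closed_convex by (simp add: convex_body_def compact_eq_bounded_closed)
qed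

lemma convex_body_shape: "convex_body shape"
proof -
  have "shape_points \<subseteq> cball 0 1"
    using shape_point_norm_le by auto
  hence "bounded (convex hull shape_points)"
    by (intro bounded_convex_hull bounded_subset[OF bounded_cball])
  thus ?thesis
    unfolding convex_body_def shape_def
    by (intro conjI convex_closure convex_convex_hull) (simp add: compact_closure)
qed

text \<open>It suffices to test the points that span \<open>shape\<close>, because \<open>room\<close> is closed and convex.\<close>

lemma placed_copy_subset_room:
  assumes "\<And>a. a \<in> shape_points \<Longrightarrow> \<rho> *v a + w \<in> room"
  shows "placed_copy \<rho> w shape \<subseteq> room"
proof -
  let ?f = "\<lambda>a. \<rho> *v a + w"
  have "convex (?f -` room)"
  proof (rule convexI)
    fix a b and u v :: real
    assume ab: "a \<in> ?f -` room" "b \<in> ?f -` room" and uv: "0 \<le> u" "0 \<le> v" "u + v = 1"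
    have "w = u *\<^sub>R w + v *\<^sub>R w" using uv(3) by (metis scaleR_left_distrib scaleR_one)
    hence "?f (u *\<^sub>R a + v *\<^sub>R b) = u *\<^sub>R ?f a + v *\<^sub>R ?f b"
      by (simp add: matrix_vector_right_distrib matrix_vector_mult_scaleR scaleR_add_right)
    thus "u *\<^sub>R a + v *\<^sub>R b \<in> ?f -` room"
      using ab uv room_closed_convex(2) by (simp add: convex_def)
  qed
  moreover have "closed (?f -` room)"
    by (intro closed_vimage room_closed_convex(1) continuous_on_add continuous_on_const
      linear_continuous_on matrix_vector_mul_bounded_linear)
  ultimately have "shape \<subseteq> ?f -` room"
    unfolding shape_def using assms by (intro closure_minimal hull_minimal) auto
  thus ?thesis by (auto simp: placed_copy_def)
qed

lemma SO_transpose: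
  assumes "\<rho> \<in> SO"
  shows "orthogonal_transformation ((*v) (transpose \<rho>))"
  using assms
  by (simp add: SO_def rotation_matrix_def orthogonal_matrix_transpose orthogonal_transformation_matrix)

lemma inner_matrix_transpose: "(\<rho> *v a) \<bullet> n = a \<bullet> (transpose \<rho> *v (n :: real ^ 'n))" for \<rho> :: "real ^ 'n ^ 'n"
  unfolding transpose_matrix_vector inner_commute[of a] dot_lmul_matrix by (rule inner_commute)

lemma kakeya_shape_room: "kakeya shape room"
  unfolding kakeya_def
proof
  fix \<rho> :: "real ^ 4 ^ 4" assume \<rho>: "\<rho> \<in> SO"
  define L where "L = (*v) (transpose \<rho>)"
  have L: "orthogonal_transformation L" unfolding L_def by (rule SO_transpose[OF \<rho>])
  have LL: "\<And>x y. L x \<bullet> L y = x \<bullet> y" using L by (auto simp: orthogonal_transformation_def)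
  define d where "d = (\<lambda>k. Min ((\<lambda>l. norm (L k - l)) ` contacts))"
  define r where "r = Max (d ` contacts)"
  \<comment> \<open>the window is narrower than the ratio of consecutive levels, so it contains at most one\<close>
  have window: "m = n" if "r / 100 < level m" "level m < 1000 * r" "r / 100 < level n" "level n < 1000 * r" for m n
  proof (rule ccontr)
    assume "m \<noteq> n"
    thus False using level_less[of m n] level_less[of n m] that by (cases "m < n") auto
  qed
  obtain x :: real where x: "x\<^sup>2 = 1" "\<And>n. r / 100 < level n \<Longrightarrow> level n < 1000 * r \<Longrightarrow> x = side n"
  proof (cases "\<exists>n. r / 100 < level n \<and> level n < 1000 * r")
    case True
    then obtain n where "r / 100 < level n \<and> level n < 1000 * r" by blast
    hence n: "r / 100 < level n" "level n < 1000 * r" by auto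
    have "side n = side m" if "r / 100 < level m" "level m < 1000 * r" for m
      using window[OF n that] by simp
    thus ?thesis using that[of "side n"] side_sq[of n] by blast
  next
    case False
    thus ?thesis using that[of 1] by auto
  qed
  define v where "v = (\<Sum>k\<in>contacts. (d k)\<^sup>2 *\<^sub>R k)"
  define w where "w = (1/2000) *\<^sub>R v + x *\<^sub>R e4"
  have d2: "0 \<le> d k" "d k \<le> 2" if k: "k \<in> contacts" for k
  proof -
    have "d k \<le> norm (L k - k)" unfolding d_def using k by (intro Min_le) auto
    also have "\<dots> \<le> 2"
      using norm_triangle_ineq4[of "L k" k] orthogonal_transformation_norm[OF L, of k] contact_inner(5)[OF k] by simp
    finally show "d k \<le> 2" .
    show "0 \<le> d k" by (simp add: d_def)
  qed
  have "norm v \<le> (\<Sum>k\<in>contacts. norm ((d k)\<^sup>2 *\<^sub>R k))" unfolding v_def by (rule norm_sum)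
  also have "\<dots> \<le> (\<Sum>k\<in>contacts. 4)"
  proof (rule sum_mono)
    fix k assume k: "k \<in> contacts"
    show "norm ((d k)\<^sup>2 *\<^sub>R k) \<le> 4"
      using power_mono[of "d k" 2 2] d2[OF k] contact_inner(5)[OF k] by simp
  qed
  also have "\<dots> \<le> 12"
    by (simp add: contacts_def card_insert_if)
  finally have nv: "norm v \<le> 12" .
  have nw: "norm w \<le> 2"
    using norm_triangle_ineq[of "(1/2000) *\<^sub>R v" "x *\<^sub>R e4"] nv x(1)
    by (auto simp: w_def power2_eq_1_iff)
  have "placed_copy \<rho> w shape \<subseteq> room"
  proof (rule placed_copy_subset_room)
    fix a assume a: "a \<in> shape_points"
    have "norm (\<rho> *v a) = norm a"
      using \<rho> orthogonal_transformation_norm[of "(*v) \<rho>" a]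
      by (simp add: SO_def rotation_matrix_def orthogonal_transformation_matrix)
    hence "norm (\<rho> *v a + w) \<le> 10"
      using norm_triangle_ineq[of "\<rho> *v a" w] shape_point_norm_le[OF a] nw by simp
    moreover have "normal u e (side n) (level n) \<bullet> (\<rho> *v a + w) \<le> 1 + 63/160 * (level n)\<^sup>2"
      if u: "u \<in> contacts" "e \<in> {-1, 1}" for u e n
    proof -
      let ?n = "normal u e (side n) (level n)"
      have 1: "?n \<bullet> (\<rho> *v a) = a \<bullet> L ?n"
        by (simp add: L_def inner_commute[of ?n] inner_matrix_transpose)
      have 2: "?n \<bullet> e4 = - 19/160 * side n * (level n)\<^sup>2"
        using contact_inner[OF u(1)] by (simp add: normal_def inner_add_left inner_diff_left inner_axis_axis)
      have "e\<^sup>2 = 1" using u by auto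
      from copy_fits[OF L u(1) this side_sq level_facts a d_def r_def x]
      show ?thesis
        by (simp add: inner_add_right 1 2 w_def v_def algebra_simps)
    qed
    ultimately show "\<rho> *v a + w \<in> room" by (auto simp: room_def)
  qed
  thus "\<exists>w. placed_copy \<rho> w shape \<subseteq> room" by blast
qed

section \<open>Small deviations force the fourth coordinate\<close>

abbreviation contact0 :: "real ^ 4" where "contact0 \<equiv> plane_vec 1 0"
abbreviation contact1 :: "real ^ 4" where "contact1 \<equiv> plane_vec (-1/2) (sqrt 3 / 2)"
abbreviation contact2 :: "real ^ 4" where "contact2 \<equiv> plane_vec (-1/2) (- sqrt 3 / 2)"

lemma contacts_eq: "contacts = {contact0, contact1, contact2}"
  by (simp add: contacts_def)

lemma contacts_sum_zero: "contact0 + contact1 + contact2 = 0" "turn contact0 + turn contact1 + turn contact2 = 0"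
  by (simp_all add: vec_eq_iff forall_4)

text \<open>
  If the block of \<open>L\<close> on the first plane is written as a multiple of a rotation plus a symmetric
  matrix of trace zero, then \<open>cos_part\<close> and \<open>sin_part\<close> are the entries of the first summand.
\<close>

definition cos_part :: "(real ^ 4 \<Rightarrow> real ^ 4) \<Rightarrow> real" where
  "cos_part L = (L (plane_vec 1 0) $ 1 + L (plane_vec 0 1) $ 2) / 2"

definition sin_part :: "(real ^ 4 \<Rightarrow> real ^ 4) \<Rightarrow> real" where
  "sin_part L = (L (plane_vec 1 0) $ 2 - L (plane_vec 0 1) $ 1) / 2"

text \<open>How far the contacts are moved out of the first plane.\<close>

definition lift :: "(real ^ 4 \<Rightarrow> real ^ 4) \<Rightarrow> real" where
  "lift L = max (norm (perp (L contact0))) (max (norm (perp (L contact1))) (norm (perp (L contact2))))"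

text \<open>
  The deviation from the standard orientation. It vanishes when the linear map \<open>L\<close> fixes the contacts. The last summand is zero
  near the standard orientation and distinguishes it from orientations with
  \<open>cos_part L < 0\<close>, such as minus the identity.
\<close>

definition deviation :: "(real ^ 4 \<Rightarrow> real ^ 4) \<Rightarrow> real" where
  "deviation L = lift L + \<bar>sin_part L\<bar> + max 0 (1/2 - cos_part L)"

lemma linear_plane_vec:
  assumes "linear L"
  shows "L (plane_vec c d) = c *\<^sub>R L (plane_vec 1 0) + d *\<^sub>R L (plane_vec 0 1)"
proof -
  have "plane_vec c d = c *\<^sub>R plane_vec 1 0 + d *\<^sub>R plane_vec 0 1"
    by (simp add: vec_eq_iff forall_4)
  thus ?thesis by (metis linear_add[OF assms] linear_scale[OF assms])
qed

lemma lift_sum_squares: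
  assumes lin: "linear L"
  defines "E \<equiv> L (plane_vec 1 0)" and "F \<equiv> L (plane_vec 0 1)"
  shows "(norm (perp (L contact0)))\<^sup>2 + (norm (perp (L contact1)))\<^sup>2 + (norm (perp (L contact2)))\<^sup>2
    = 3/2 * ((E$3)\<^sup>2 + (E$4)\<^sup>2 + (F$3)\<^sup>2 + (F$4)\<^sup>2)"
proof -
  have key: "((- 1/2) * x + sqrt 3 / 2 * y)\<^sup>2 + ((- 1/2) * x + (- sqrt 3 / 2) * y)\<^sup>2 = x\<^sup>2 / 2 + 3/2 * y\<^sup>2" for x y :: real
    by (simp add: power2_eq_square algebra_simps)
  have n: "(norm (perp v))\<^sup>2 = (v$3)\<^sup>2 + (v$4)\<^sup>2" for v
    unfolding power2_norm_eq_inner by (simp add: inner_4 power2_eq_square)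
  show ?thesis
    unfolding n linear_plane_vec[OF lin, of "-1/2"] E_def[symmetric] F_def[symmetric]
      vector_add_component vector_scaleR_component real_scaleR_def
    using key[of "E$3" "F$3"] key[of "E$4" "F$4"] by argo
qed

text \<open>
  Let \<open>(E1, E2)\<close> and \<open>(F1, F2)\<close> be the columns of the block of an orthogonal map on the first plane,
  \<open>e\<close>, \<open>f\<close> the squared norms and \<open>ef\<close> the inner product of their completions. Orthonormality of the full
  columns makes the trace-free symmetric part \<open>(a, b)\<close> of the block quadratically small in the completions.
\<close>

lemma block_defect_bounds:
  fixes E1 E2 F1 F2 e f ef p \<beta> a b :: real
  assumes E: "E1\<^sup>2 + E2\<^sup>2 + e = 1" and F: "F1\<^sup>2 + F2\<^sup>2 + f = 1" and EF: "E1 * F1 + E2 * F2 + ef = 0"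
    and cs: "ef\<^sup>2 \<le> e * f" and ef: "0 \<le> e" "0 \<le> f" "e + f \<le> 2 * Z\<^sup>2"
    and p: "p = (E1 + F2) / 2" and \<beta>: "\<beta> = (E2 - F1) / 2"
    and a: "a = (E1 - F2) / 2" and b: "b = (E2 + F1) / 2"
    and p0: "2/5 \<le> p"
  shows "a\<^sup>2 + b\<^sup>2 \<le> 2 * (Z\<^sup>2)\<^sup>2" and "p\<^sup>2 = 1 - (\<beta>\<^sup>2 + (a\<^sup>2 + b\<^sup>2) + (e + f) / 2)"
proof -
  have coords: "E1 = p + a" "F2 = p - a" "E2 = \<beta> + b" "F1 = b - \<beta>"
    by (simp_all add: p \<beta> a b field_simps)
  show "p\<^sup>2 = 1 - (\<beta>\<^sup>2 + (a\<^sup>2 + b\<^sup>2) + (e + f) / 2)"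
    using E F unfolding coords by (simp add: power2_eq_square field_simps)
  have 1: "p * a + \<beta> * b = (f - e) / 4"
    using E F unfolding coords by (simp add: power2_eq_square algebra_simps)
  have 2: "p * b - \<beta> * a = - ef / 2"
    using EF unfolding coords by (simp add: power2_eq_square algebra_simps)
  have "(p\<^sup>2 + \<beta>\<^sup>2) * (a\<^sup>2 + b\<^sup>2) = (p * a + \<beta> * b)\<^sup>2 + (p * b - \<beta> * a)\<^sup>2"
    by (simp add: power2_eq_square algebra_simps)
  also have "\<dots> = ((f - e)\<^sup>2 + 4 * ef\<^sup>2) / 16"
    unfolding 1 2 by (simp add: power2_eq_square field_simps)
  also have "\<dots> \<le> (e + f)\<^sup>2 / 16"
    using cs by (simp add: power2_eq_square algebra_simps)
  also have "\<dots> \<le> (2 * Z\<^sup>2)\<^sup>2 / 16"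
    using ef by (intro divide_right_mono power_mono) auto
  finally have up: "(p\<^sup>2 + \<beta>\<^sup>2) * (a\<^sup>2 + b\<^sup>2) \<le> (Z\<^sup>2)\<^sup>2 / 4" by (simp add: power_mult_distrib)
  have "(2/5)\<^sup>2 \<le> p\<^sup>2" using p0 by (intro power_mono) auto
  hence "4/25 \<le> p\<^sup>2" by (simp add: power_divide)
  hence "1/8 \<le> p\<^sup>2 + \<beta>\<^sup>2" using zero_le_power2[of \<beta>] by linarith
  hence "1/8 * (a\<^sup>2 + b\<^sup>2) \<le> (p\<^sup>2 + \<beta>\<^sup>2) * (a\<^sup>2 + b\<^sup>2)" by (intro mult_right_mono) auto
  hence "1/8 * (a\<^sup>2 + b\<^sup>2) \<le> (Z\<^sup>2)\<^sup>2 / 4" using up by (rule order.trans)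
  thus "a\<^sup>2 + b\<^sup>2 \<le> 2 * (Z\<^sup>2)\<^sup>2" by simp
qed

lemma one_minus_sqrt_le:
  fixes p w :: real
  assumes "0 \<le> p" "p\<^sup>2 = 1 - w" "0 \<le> w"
  shows "1 - w / 2 - w\<^sup>2 / 2 \<le> p" and "p \<le> 1"
proof -
  have "p\<^sup>2 \<le> 1\<^sup>2" using assms by simp
  thus p1: "p \<le> 1" by (rule power2_le_imp_le) simp
  have "p * p \<le> p * 1" using p1 assms(1) by (rule mult_left_mono)
  hence pw: "1 - p \<le> w" using assms(2) by (simp add: power2_eq_square)
  have "(1 - p)\<^sup>2 \<le> w\<^sup>2" using pw p1 by (intro power_mono) auto
  thus "1 - w / 2 - w\<^sup>2 / 2 \<le> p" using assms(2) by (simp add: power2_eq_square algebra_simps)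
qed

lemma contact_block:
  assumes lin: "linear L" and u: "u \<in> contacts"
  defines "E \<equiv> L (plane_vec 1 0)" and "F \<equiv> L (plane_vec 0 1)"
  defines "a \<equiv> (E$1 - F$2) / 2" and "b \<equiv> (E$2 + F$1) / 2"
  shows "\<bar>turn u \<bullet> L u - sin_part L\<bar> \<le> \<bar>a\<bar> + \<bar>b\<bar>"
    and "cos_part L - (\<bar>a\<bar> + \<bar>b\<bar>) \<le> turn u \<bullet> L (turn u)"
proof -
  define c d where "c = u$1" and "d = u$2"
  have cd: "c * c + d * d = 1" and "u$3 = 0" "u$4 = 0" using contact_facts[OF u] by (simp_all add: c_def d_def)
  hence uu: "u = plane_vec c d" "turn u = plane_vec (- d) c" by (simp_all add: vec_eq_iff forall_4 c_def d_def)
  have Lu: "L u = c *\<^sub>R E + d *\<^sub>R F" "L (turn u) = (- d) *\<^sub>R E + c *\<^sub>R F"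
    unfolding uu(2) E_def F_def by (subst uu(1)) (rule linear_plane_vec[OF lin])+
  have dd: "d * d = 1 - c * c" using cd by simp
  have 1: "turn u \<bullet> L u - sin_part L = (c * c - d * d) * b - (2 * c * d) * a"
    unfolding Lu sin_part_def E_def[symmetric] F_def[symmetric] a_def b_def
    unfolding uu inner_4
    apply (simp add: field_simps)
    using cd by algebra
  have 2: "turn u \<bullet> L (turn u) - cos_part L = - ((c * c - d * d) * a + (2 * c * d) * b)"
    unfolding Lu cos_part_def E_def[symmetric] F_def[symmetric] a_def b_def
    unfolding uu inner_4
    apply (simp add: field_simps)
    using cd by algebra
  have "0 \<le> c * c + d * d - 2 * c * d" "0 \<le> c * c + d * d + 2 * c * d"
    using zero_le_square[of "c - d"] zero_le_square[of "c + d"] by (simp_all add: algebra_simps)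
  hence "\<bar>c * c - d * d\<bar> \<le> 1" "\<bar>2 * c * d\<bar> \<le> 1"
    using cd zero_le_square[of c] zero_le_square[of d] by linarith+
  hence m: "\<bar>(c * c - d * d) * y\<bar> \<le> \<bar>y\<bar>" "\<bar>(2 * c * d) * y\<bar> \<le> \<bar>y\<bar>" for y
    unfolding abs_mult[of _ y] by (auto intro: mult_left_le_one_le)
  show "\<bar>turn u \<bullet> L u - sin_part L\<bar> \<le> \<bar>a\<bar> + \<bar>b\<bar>"
    unfolding 1 using m(1)[of b] m(2)[of a] by linarith
  show "cos_part L - (\<bar>a\<bar> + \<bar>b\<bar>) \<le> turn u \<bullet> L (turn u)"
    using 2 m(1)[of a] m(2)[of b] by linarith
qed

lemma sqrt_one_minus_ge:
  fixes g :: real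
  assumes "0 \<le> g" "g \<le> 1/1000"
  shows "1 - g\<^sup>2 - g ^ 4 \<le> sqrt (1 - 2 * g\<^sup>2)"
proof (rule real_le_rsqrt)
  define h where "h = g\<^sup>2"
  have h: "0 \<le> h" "h \<le> 1/1000000" using power_mono[OF assms(2,1), of 2] by (simp_all add: h_def power2_eq_square)
  have "g ^ 4 = h * h" by (simp add: h_def power2_eq_square power4_eq_xxxx)
  hence "(1 - g\<^sup>2 - g ^ 4)\<^sup>2 = (1 - h - h * h)\<^sup>2" by (simp add: h_def)
  also have "\<dots> = 1 - 2 * h - h * h * (1 - 2 * h - h * h)"
    by (simp add: power2_eq_square algebra_simps)
  also have "\<dots> \<le> 1 - 2 * h"
  proof -
    have "h * h \<le> 1 * h" using h by (intro mult_right_mono) auto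
    hence "0 \<le> 1 - 2 * h - h * h" using h by linarith
    thus ?thesis using h by simp
  qed
  finally show "(1 - g\<^sup>2 - g ^ 4)\<^sup>2 \<le> 1 - 2 * g\<^sup>2" by (simp add: h_def)
qed

lemma perp_direction:
  obtains X :: "real ^ 4" where "norm X = 1" "X $ 1 = 0" "X $ 2 = 0" "X \<bullet> v = norm (perp v)"
proof (cases "perp v = 0")
  case True
  have "v $ 4 = 0" using True by (simp add: vec_eq_iff forall_4)
  thus ?thesis using that[of e4] True by (simp add: inner_4)
next
  case False
  define X where "X = perp v /\<^sub>R norm (perp v)"
  have "perp v \<bullet> v = perp v \<bullet> perp v" by (simp add: inner_4)
  hence "X \<bullet> v = norm (perp v)" using False
    by (simp add: X_def dot_square_norm power2_eq_square)
  moreover have "norm X = 1" using False by (simp add: X_def)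
  ultimately show ?thesis using that[of X] by (simp add: X_def)
qed

text \<open>
  A point of \<open>shape\<close> that nearly maximises the normal \<open>normal u e s Y\<close> after a rotation with deviation
  comparable to \<open>Y\<close>. It is chosen on the boundary of the double cone at \<open>u\<close>, in the direction \<open>X\<close> in which
  \<open>u\<close> is lifted.
\<close>

lemma test_point:
  assumes L: "orthogonal_transformation L"
    and u: "u \<in> contacts" "e\<^sup>2 = 1" "s\<^sup>2 = 1" "0 < Y" "Y \<le> 1/100000"
    and Z: "0 \<le> Z" "Z = Y - \<bar>\<beta>\<bar>" "e * \<beta> = - \<bar>\<beta>\<bar>"
    and x: "\<And>k. k \<in> contacts \<Longrightarrow> norm (perp (L k)) \<le> Z"
    and t: "\<bar>turn u \<bullet> L u - \<beta>\<bar> \<le> 3 * Y\<^sup>2" "1 - 4 * Y\<^sup>2 \<le> turn u \<bullet> L (turn u)"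
  shows "\<exists>a\<in>shape_points. u \<bullet> L (normal u e s Y) + \<kappa> / 4 * (Z + norm (perp (L u)))\<^sup>2 - 10 * Y ^ 3
      \<le> a \<bullet> L (normal u e s Y)"
proof -
  let ?v = "L (normal u e s Y)"
  have lin: "linear L" and LL: "\<And>x y. L x \<bullet> L y = x \<bullet> y"
    using L by (auto simp: orthogonal_transformation_def)
  define \<xi> where "\<xi> = norm (perp (L u))"
  define g where "g = (Z + \<xi>) / 2"
  have \<xi>: "0 \<le> \<xi>" "\<xi> \<le> Z" using x[OF u(1)] by (simp_all add: \<xi>_def)
  have ZY: "Z \<le> Y" using Z by simp
  have g: "0 \<le> g" "g \<le> Y" using \<xi> Z(1) ZY by (simp_all add: g_def)
  obtain X :: "real ^ 4" where X: "norm X = 1" "X $ 1 = 0" "X $ 2 = 0" "X \<bullet> L u = \<xi>"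
    unfolding \<xi>_def by (rule perp_direction)
  have XX: "X \<bullet> X = 1" using X(1) by (simp add: norm_eq_1)
  have Xu: "X \<bullet> u = 0" "X \<bullet> turn u = 0" "u \<bullet> X = 0" "turn u \<bullet> X = 0" "perp X = X"
    using X contact_facts[OF u(1)] by (simp_all add: inner_4 vec_eq_iff forall_4)
  define c where "c = sqrt (1 - 2 * g\<^sup>2)"
  have Y2: "Y\<^sup>2 \<le> 1/100000"
    using mult_mono[of Y "1/100000" Y 1] u by (simp add: power2_eq_square)
  have g2: "g\<^sup>2 \<le> Y\<^sup>2" using g by (intro power_mono) auto
  have c2: "c\<^sup>2 = 1 - 2 * g\<^sup>2" unfolding c_def using g2 Y2 by (intro real_sqrt_pow2) linarith
  define q where "q = c *\<^sub>R u + (e * g) *\<^sub>R turn u + g *\<^sub>R X"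
  have "q \<bullet> q = c\<^sup>2 + e\<^sup>2 * g\<^sup>2 + g\<^sup>2"
    unfolding q_def using Xu XX contact_inner[OF u(1)]
    by (simp add: inner_add_left inner_add_right power2_eq_square)
  hence q1: "norm q = 1" using c2 u(2) by (simp add: norm_eq_1)
  have tq: "turn u \<bullet> q = e * g"
    unfolding q_def using Xu contact_inner[OF u(1)] by (simp add: inner_add_right)
  have pq: "perp q = g *\<^sub>R X"
    unfolding q_def using Xu contact_facts[OF u(1)] X by (simp add: vec_eq_iff forall_4)
  have e: "e = 1 \<or> e = -1" using u(2) by (simp only: power2_eq_1_iff)
  hence "\<bar>turn u \<bullet> q\<bar> \<le> norm (perp q)" unfolding tq pq using g X(1) by (auto simp: abs_mult)
  hence a: "(1 - \<kappa>) *\<^sub>R u + \<kappa> *\<^sub>R q \<in> shape_points"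
    unfolding shape_points_def using u(1) q1 by blast
  have v: "?v = L u + (e * Y) *\<^sub>R L (turn u) - (19/160 * s * Y\<^sup>2) *\<^sub>R L e4"
    by (simp add: normal_def linear_add[OF lin] linear_diff[OF lin] linear_scale[OF lin])
  have small: "\<bar>19/160 * s * Y\<^sup>2 * (z \<bullet> L e4)\<bar> \<le> Y\<^sup>2" if "norm z = 1" for z
  proof -
    have "\<bar>z \<bullet> L e4\<bar> \<le> 1"
      using Cauchy_Schwarz_ineq2[of z "L e4"] that orthogonal_transformation_norm[OF L, of e4] by simp
    moreover have "\<bar>19/160 * s * Y\<^sup>2\<bar> \<le> Y\<^sup>2"
      using u(3) by (auto simp: power2_eq_1_iff abs_mult)
    ultimately show ?thesis unfolding abs_mult[of _ "z \<bullet> L e4"]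
      using mult_mono[of "\<bar>19/160 * s * Y\<^sup>2\<bar>" "Y\<^sup>2" "\<bar>z \<bullet> L e4\<bar>" 1] by simp
  qed
  have Y3: "Y ^ 3 = Y * Y\<^sup>2" by (simp add: power2_eq_square power3_eq_cube)
  have YY: "Y * Y\<^sup>2 \<le> 1/100000 * Y\<^sup>2" using u by (intro mult_right_mono) auto
  have YY0: "0 \<le> Y * Y\<^sup>2" using u(4) by simp
  have vt: "Z - 6 * Y\<^sup>2 \<le> e * (turn u \<bullet> ?v)"
  proof -
    have ee: "e * e = 1" using u(2) by (simp add: power2_eq_square)
    have "e * (turn u \<bullet> ?v) = e * (turn u \<bullet> L u) + (e * e) * (Y * (turn u \<bullet> L (turn u)))
        - e * (19/160 * s * Y\<^sup>2 * (turn u \<bullet> L e4))"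
      unfolding v by (simp add: inner_add_right inner_diff_right algebra_simps)
    also have "\<dots> = e * (turn u \<bullet> L u - \<beta>) + e * \<beta> + Y * (turn u \<bullet> L (turn u)) - e * (19/160 * s * Y\<^sup>2 * (turn u \<bullet> L e4))"
      unfolding ee by (simp add: algebra_simps)
    finally have eq: "e * (turn u \<bullet> ?v) = \<dots>" .
    have "Y * (1 - 4 * Y\<^sup>2) \<le> Y * (turn u \<bullet> L (turn u))"
      using t(2) u by (intro mult_left_mono) auto
    hence 1: "Y - 4 * (Y * Y\<^sup>2) \<le> Y * (turn u \<bullet> L (turn u))" by (simp add: algebra_simps)
    have 2: "- (3 * Y\<^sup>2) \<le> e * (turn u \<bullet> L u - \<beta>)"
      using e t(1) by auto
    have 3: "e * (19/160 * s * Y\<^sup>2 * (turn u \<bullet> L e4)) \<le> Y\<^sup>2"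
      using e small[OF contact_inner(6)[OF u(1)]] by (auto simp: abs_le_iff)
    show ?thesis unfolding eq Z(3) using 1 2 3 Z(2) YY zero_le_power2[of Y] by linarith
  qed
  have vx: "\<xi> - 3 * Y\<^sup>2 \<le> X \<bullet> ?v"
  proof -
    have "X \<bullet> L (turn u) = X \<bullet> perp (L (turn u))" using X by (simp add: inner_4)
    hence "\<bar>X \<bullet> L (turn u)\<bar> \<le> 2 * Z"
      using Cauchy_Schwarz_ineq2[of X "perp (L (turn u))"] X(1) perp_turn_le[OF lin u(1) x] by simp
    hence "\<bar>X \<bullet> L (turn u)\<bar> \<le> 2 * Y" using ZY by simp
    hence "Y * \<bar>X \<bullet> L (turn u)\<bar> \<le> Y * (2 * Y)" using u by (intro mult_left_mono) auto
    hence "\<bar>e * Y * (X \<bullet> L (turn u))\<bar> \<le> 2 * Y\<^sup>2"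
      using e u by (auto simp: abs_mult power2_eq_square)
    thus ?thesis using small[OF X(1)] unfolding v
      by (simp add: inner_add_right inner_diff_right X(4) abs_le_iff)
  qed
  have vu: "u \<bullet> ?v \<le> 1 + Y\<^sup>2"
  proof -
    have "u \<bullet> ?v \<le> norm u * norm ?v" by (rule norm_cauchy_schwarz)
    also have "\<dots> \<le> 1 + (5001/10000) * Y\<^sup>2"
      using norm_normal_le[OF u] orthogonal_transformation_norm[OF L] contact_inner(5)[OF u(1)] by simp
    also have "\<dots> \<le> 1 + Y\<^sup>2" using zero_le_power2[of Y] by linarith
    finally show ?thesis .
  qed
  have g4: "g ^ 4 \<le> Y * Y\<^sup>2 / 100"
  proof -
    have "g ^ 4 \<le> Y ^ 4" using g by (intro power_mono) auto
    also have "Y ^ 4 = Y * (Y * Y\<^sup>2)" by (simp add: power2_eq_square power4_eq_xxxx)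
    also have "\<dots> \<le> 1/100 * (Y * Y\<^sup>2)" using u by (intro mult_right_mono) auto
    finally show ?thesis by simp
  qed
  have cu: "u \<bullet> ?v - g\<^sup>2 - Y * Y\<^sup>2 \<le> c * (u \<bullet> ?v)"
  proof -
    have "g \<le> 1/1000" using g u by linarith
    hence "1 - c \<le> g\<^sup>2 + g ^ 4" using sqrt_one_minus_ge[OF g(1)] unfolding c_def by simp
    hence "(1 - c) * (1 + Y\<^sup>2) \<le> (g\<^sup>2 + g ^ 4) * (1 + Y\<^sup>2)" by (intro mult_right_mono) auto
    moreover have "(1 - c) * (u \<bullet> ?v) \<le> (1 - c) * (1 + Y\<^sup>2)"
      using vu by (intro mult_left_mono) (auto simp: c_def)
    ultimately have "(1 - c) * (u \<bullet> ?v) \<le> (g\<^sup>2 + g ^ 4) * (1 + Y\<^sup>2)" by linarith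
    also have "\<dots> = g\<^sup>2 + g ^ 4 + g\<^sup>2 * Y\<^sup>2 + g ^ 4 * Y\<^sup>2" by (simp add: algebra_simps)
    also have "g\<^sup>2 * Y\<^sup>2 \<le> Y * Y\<^sup>2 / 100"
    proof -
      have "g\<^sup>2 * Y\<^sup>2 \<le> Y\<^sup>2 * Y\<^sup>2" using g2 by (intro mult_right_mono) auto
      also have "\<dots> = Y * (Y * Y\<^sup>2)" by (simp add: power2_eq_square)
      also have "\<dots> \<le> 1/100 * (Y * Y\<^sup>2)" using u by (intro mult_right_mono) auto
      finally show ?thesis by simp
    qed
    also have "g ^ 4 * Y\<^sup>2 \<le> g ^ 4 * 1"
    proof (rule mult_left_mono)
      show "Y\<^sup>2 \<le> 1" using Y2 by linarith
      show "0 \<le> g ^ 4" using g(1) by (rule zero_le_power)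
    qed
    finally have "(1 - c) * (u \<bullet> ?v) \<le> g\<^sup>2 + Y * Y\<^sup>2" using g4 YY0 by linarith
    thus ?thesis by (simp add: algebra_simps)
  qed
  have "g * (Z - 6 * Y\<^sup>2) \<le> g * (e * (turn u \<bullet> ?v))" "g * (\<xi> - 3 * Y\<^sup>2) \<le> g * (X \<bullet> ?v)"
    using vt vx g by (auto intro: mult_left_mono)
  moreover have "q \<bullet> ?v = c * (u \<bullet> ?v) + g * (e * (turn u \<bullet> ?v)) + g * (X \<bullet> ?v)"
    by (simp add: q_def inner_add_left)
  moreover have "g * (9 * Y\<^sup>2) \<le> Y * (9 * Y\<^sup>2)" using g by (intro mult_right_mono) auto
  moreover have "g * (Z - 6 * Y\<^sup>2) + g * (\<xi> - 3 * Y\<^sup>2) = 2 * g\<^sup>2 - g * (9 * Y\<^sup>2)"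
    by (simp add: g_def power2_eq_square field_simps)
  ultimately have "u \<bullet> ?v + g\<^sup>2 - 10 * (Y * Y\<^sup>2) \<le> q \<bullet> ?v"
    using cu by linarith
  moreover have "((1 - \<kappa>) *\<^sub>R u + \<kappa> *\<^sub>R q) \<bullet> ?v = 1/100 * (u \<bullet> ?v) + 99/100 * (q \<bullet> ?v)"
    by (simp add: inner_add_left \<kappa>_def)
  moreover have "\<kappa> / 4 * (Z + \<xi>)\<^sup>2 = 99/100 * g\<^sup>2"
    by (simp add: \<kappa>_def g_def power2_eq_square)
  ultimately have "u \<bullet> ?v + \<kappa> / 4 * (Z + \<xi>)\<^sup>2 - 10 * (Y * Y\<^sup>2) \<le> ((1 - \<kappa>) *\<^sub>R u + \<kappa> *\<^sub>R q) \<bullet> ?v"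
    using YY0 by linarith
  thus ?thesis using a unfolding \<xi>_def Y3 by (intro bexI[of _ "(1 - \<kappa>) *\<^sub>R u + \<kappa> *\<^sub>R q"]) auto
qed

lemma turn_plane_vec: "turn (plane_vec c d) = plane_vec (- d) c"
  by (simp add: vec_eq_iff forall_4)

lemma contact_block_sums:
  assumes lin: "linear L"
  shows "contact0 \<bullet> L contact0 + contact1 \<bullet> L contact1 + contact2 \<bullet> L contact2 = 3 * cos_part L"
    and "contact0 \<bullet> L (turn contact0) + contact1 \<bullet> L (turn contact1) + contact2 \<bullet> L (turn contact2) = - 3 * sin_part L"
proof -
  have q: "plane_vec c d \<bullet> L (plane_vec c' d') = c * (c' * L (plane_vec 1 0) $ 1 + d' * L (plane_vec 0 1) $ 1)
      + d * (c' * L (plane_vec 1 0) $ 2 + d' * L (plane_vec 0 1) $ 2)" for c d c' d'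
    unfolding linear_plane_vec[OF lin, of c' d'] by (simp add: inner_4)
  have r: "sqrt 3 * (sqrt 3 * z) = 3 * z" for z by (simp flip: mult.assoc)
  show "contact0 \<bullet> L contact0 + contact1 \<bullet> L contact1 + contact2 \<bullet> L contact2 = 3 * cos_part L"
    unfolding q cos_part_def by (simp add: field_simps r)
  show "contact0 \<bullet> L (turn contact0) + contact1 \<bullet> L (turn contact1) + contact2 \<bullet> L (turn contact2) = - 3 * sin_part L"
    unfolding turn_plane_vec q sin_part_def by (simp add: field_simps r)
qed

lemma normal_sum: "normal contact0 e s Y + normal contact1 e s Y + normal contact2 e s Y = (- (57/160) * s * Y\<^sup>2) *\<^sub>R e4"
  by (simp add: vec_eq_iff forall_4 normal_def)

text \<open>
  The norms of three vectors with sum zero satisfy these inequalities: the largest norm is \<open>Z\<close> and the other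
  two add up to at least \<open>Z\<close>.
\<close>

lemma defect_sum_le:
  fixes Z x y z :: real
  assumes "0 \<le> x" "0 \<le> y" "0 \<le> z" "Z = max x (max y z)"
    and tri: "x \<le> y + z" "y \<le> x + z" "z \<le> x + y"
  shows "(Z - x)\<^sup>2 + (Z - y)\<^sup>2 + (Z - z)\<^sup>2 \<le> Z\<^sup>2"
proof -
  have two: "(Z - a)\<^sup>2 + (Z - b)\<^sup>2 \<le> Z\<^sup>2" if "a \<le> Z" "b \<le> Z" "Z \<le> a + b" for a b
  proof -
    have "0 \<le> (Z - a) * (Z - b)" using that by simp
    moreover have "((Z - a) + (Z - b))\<^sup>2 \<le> Z\<^sup>2" using that by (intro power_mono) auto
    ultimately show ?thesis by (simp add: power2_eq_square algebra_simps)
  qed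
  have le: "x \<le> Z" "y \<le> Z" "z \<le> Z" using assms by auto
  have "Z = x \<or> Z = y \<or> Z = z" using assms(4) by (auto simp: max_def)
  thus ?thesis using two[of y z] two[of x z] two[of x y] le tri by auto
qed

text \<open>
  If a copy with deviation exactly \<open>Y\<close> satisfies the half-space conditions at scale \<open>Y\<close>, its fourth coordinate
  is on the side \<open>s\<close>. The conditions with the same sign \<open>e\<close>, chosen against the direction in which the
  copy is turned in the first plane, are added over the three contacts: the first two coordinates of \<open>w\<close> cancel.
\<close>

lemma blocking:
  assumes L: "orthogonal_transformation L" and s: "s\<^sup>2 = 1" and Y: "0 < Y" "Y \<le> 1/100000"
    and G: "deviation L = Y"
    and fits: "\<And>a u e. a \<in> shape_points \<Longrightarrow> u \<in> contacts \<Longrightarrow> e\<^sup>2 = 1 \<Longrightarrow>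
      a \<bullet> L (normal u e s Y) + normal u e s Y \<bullet> w \<le> 1 + 63/160 * Y\<^sup>2"
  shows "1/20 \<le> s * w $ 4"
proof -
  have lin: "linear L" and LL: "\<And>x y. L x \<bullet> L y = x \<bullet> y"
    using L by (auto simp: orthogonal_transformation_def)
  define E F where "E = L (plane_vec 1 0)" and "F = L (plane_vec 0 1)"
  define a b where "a = (E$1 - F$2) / 2" and "b = (E$2 + F$1) / 2"
  define p \<beta> where "p = cos_part L" and "\<beta> = sin_part L"
  define Z where "Z = lift L"
  define x where "x = (\<lambda>k. norm (perp (L k)))"
  define h where "h = (E$3)\<^sup>2 + (E$4)\<^sup>2 + ((F$3)\<^sup>2 + (F$4)\<^sup>2)"
  have xZ: "x k \<le> Z" if "k \<in> contacts" for k
    using that by (auto simp: x_def Z_def lift_def contacts_eq)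
  have x0: "0 \<le> x k" for k by (simp add: x_def)
  have Z0: "0 \<le> Z" using x0[of contact0] xZ[of contact0] by (simp add: contacts_eq)
  have GY: "Z + \<bar>\<beta>\<bar> + max 0 (1/2 - p) = Y"
    using G by (simp add: deviation_def Z_def \<beta>_def p_def)
  hence p0: "2/5 \<le> p" and ZY: "Z \<le> Y" and \<beta>Y: "\<bar>\<beta>\<bar> \<le> Y" using Y Z0 by linarith+
  have Y2: "Y\<^sup>2 \<le> 1/100000"
    using mult_mono[of Y "1/100000" Y 1] Y by (simp add: power2_eq_square)
  have YY: "Y\<^sup>2 * Y\<^sup>2 \<le> 1/100000 * Y ^ 3"
  proof -
    have "Y\<^sup>2 * Y\<^sup>2 = Y * Y ^ 3" by (simp add: power2_eq_square power3_eq_cube)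
    also have "\<dots> \<le> 1/100000 * Y ^ 3" using Y by (intro mult_right_mono) auto
    finally show ?thesis .
  qed
  have Y3: "Y ^ 3 \<le> 1/100000 * Y\<^sup>2" "0 \<le> Y ^ 3"
    using Y mult_right_mono[of Y "1/100000" "Y\<^sup>2"] by (simp_all add: power2_eq_square power3_eq_cube)
  have Z2: "Z\<^sup>2 \<le> Y\<^sup>2" using ZY Z0 by (intro power_mono) auto
  have \<beta>2: "\<beta>\<^sup>2 \<le> Y\<^sup>2" using \<beta>Y by (metis abs_ge_zero power2_abs power_mono)
  have Z4: "(Z\<^sup>2)\<^sup>2 \<le> Y\<^sup>2 * Y\<^sup>2" unfolding power2_eq_square[of "Z\<^sup>2"] using Z2 by (intro mult_mono) auto
  have sq: "(x contact0)\<^sup>2 + (x contact1)\<^sup>2 + (x contact2)\<^sup>2 = 3/2 * h"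
    using lift_sum_squares[OF lin] by (simp add: x_def h_def E_def F_def add.assoc)
  have x2: "(x k)\<^sup>2 \<le> Z\<^sup>2" if "k \<in> contacts" for k
    using xZ[OF that] x0 by (intro power_mono) auto
  have h: "h \<le> 2 * Z\<^sup>2"
    using sq x2[of contact0] x2[of contact1] x2[of contact2] by (simp add: contacts_eq)
  have "a\<^sup>2 + b\<^sup>2 \<le> 2 * (Z\<^sup>2)\<^sup>2 \<and> p\<^sup>2 = 1 - (\<beta>\<^sup>2 + (a\<^sup>2 + b\<^sup>2) + h / 2)"
  proof -
    have "plane_vec 1 0 \<bullet> plane_vec 1 0 = 1" "plane_vec 0 1 \<bullet> plane_vec 0 1 = 1" "plane_vec 1 0 \<bullet> plane_vec 0 1 = 0"
      by (simp_all add: inner_4)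
    hence EE: "E \<bullet> E = 1" "F \<bullet> F = 1" "E \<bullet> F = 0" unfolding E_def F_def LL by auto
    have E1: "(E$1)\<^sup>2 + (E$2)\<^sup>2 + ((E$3)\<^sup>2 + (E$4)\<^sup>2) = 1" 
      and F1: "(F$1)\<^sup>2 + (F$2)\<^sup>2 + ((F$3)\<^sup>2 + (F$4)\<^sup>2) = 1"
      and EF: "E$1 * F$1 + E$2 * F$2 + (E$3 * F$3 + E$4 * F$4) = 0"
      using EE by (simp_all add: inner_4 power2_eq_square add.assoc)
    have cs: "(E$3 * F$3 + E$4 * F$4)\<^sup>2 \<le> ((E$3)\<^sup>2 + (E$4)\<^sup>2) * ((F$3)\<^sup>2 + (F$4)\<^sup>2)"
      using zero_le_square[of "E$3 * F$4 - E$4 * F$3"] by (simp add: power2_eq_square algebra_simps)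
    show ?thesis
      using block_defect_bounds[OF E1 F1 EF cs _ _ _ _ _ a_def b_def p0, of Z \<beta>] h
      by (simp add: h_def p_def \<beta>_def cos_part_def sin_part_def E_def F_def)
  qed
  hence ab: "a\<^sup>2 + b\<^sup>2 \<le> 2 * (Z\<^sup>2)\<^sup>2" and p2: "p\<^sup>2 = 1 - (\<beta>\<^sup>2 + (a\<^sup>2 + b\<^sup>2) + h / 2)" by auto
  define v where "v = \<beta>\<^sup>2 + (a\<^sup>2 + b\<^sup>2) + h / 2"
  have ab0: "0 \<le> a\<^sup>2 + b\<^sup>2" by simp
  have h0: "0 \<le> h" by (simp add: h_def)
  have v0: "0 \<le> v" using ab0 h0 by (simp add: v_def)
  have v3: "v \<le> 3 * Y\<^sup>2"
    unfolding v_def using ab h Z2 \<beta>2 Z4 YY Y3 zero_le_power2[of Y] by linarith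
  have v2: "v\<^sup>2 \<le> 9 * (Y\<^sup>2 * Y\<^sup>2)" 
    using power_mono[OF v3 v0, of 2] by (simp add: power2_eq_square)
  have p1: "1 - v / 2 - v\<^sup>2 / 2 \<le> p" "p \<le> 1"
    using one_minus_sqrt_le[of p v] p0 p2 v0 by (simp_all add: v_def)
  \<comment> \<open>hence the last summand of the deviation vanishes\<close>
  have p': "1 - 2 * Y\<^sup>2 \<le> p" using p1 v3 v2 YY Y3 zero_le_power2[of Y] by linarith
  hence Z: "Z = Y - \<bar>\<beta>\<bar>" using GY Y2 by simp
  have sab: "\<bar>a\<bar> + \<bar>b\<bar> \<le> 2 * Z\<^sup>2"
  proof (rule power2_le_imp_le)
    have "0 \<le> (\<bar>a\<bar> - \<bar>b\<bar>)\<^sup>2" by simp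
    hence "(\<bar>a\<bar> + \<bar>b\<bar>)\<^sup>2 \<le> 2 * (a\<^sup>2 + b\<^sup>2)" by (simp add: power2_sum power2_diff)
    thus "(\<bar>a\<bar> + \<bar>b\<bar>)\<^sup>2 \<le> (2 * Z\<^sup>2)\<^sup>2" using ab by (simp add: power_mult_distrib)
  qed simp
  define e :: real where "e = (if 0 \<le> \<beta> then -1 else 1)"
  have e: "e\<^sup>2 = 1" "e * \<beta> = - \<bar>\<beta>\<bar>" by (auto simp: e_def)
  have test: "\<exists>c. c \<in> shape_points \<and> u \<bullet> L (normal u e s Y) + 99/400 * (Z + x u)\<^sup>2 - 10 * Y ^ 3 \<le> c \<bullet> L (normal u e s Y)"
    if u: "u \<in> contacts" for u
  proof -
    have t: "\<bar>turn u \<bullet> L u - \<beta>\<bar> \<le> 3 * Y\<^sup>2" "1 - 4 * Y\<^sup>2 \<le> turn u \<bullet> L (turn u)"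
      using contact_block[OF lin u] sab Z2 p' zero_le_power2[of Y]
      unfolding E_def[symmetric] F_def[symmetric] a_def[symmetric] b_def[symmetric] p_def[symmetric] \<beta>_def[symmetric]
      by linarith+
    show ?thesis
      using test_point[OF L u e(1) s Y Z0 Z e(2) xZ[unfolded x_def] t]
      by (auto simp: x_def \<kappa>_def)
  qed
  have inC: "contact0 \<in> contacts" "contact1 \<in> contacts" "contact2 \<in> contacts" by (auto simp: contacts_eq)
  define n where "n = (\<lambda>u. normal u e s Y)"
  have each: "u \<bullet> L (n u) + 99/400 * (Z + x u)\<^sup>2 - 10 * Y ^ 3 + n u \<bullet> w \<le> 1 + 63/160 * Y\<^sup>2"
    if u: "u \<in> contacts" for u
  proof -
    obtain c where "c \<in> shape_points" "u \<bullet> L (n u) + 99/400 * (Z + x u)\<^sup>2 - 10 * Y ^ 3 \<le> c \<bullet> L (n u)"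
      using test[OF u] unfolding n_def by blast
    thus ?thesis using fits[of c u e] u e(1) unfolding n_def by force
  qed
  have nw: "n contact0 \<bullet> w + n contact1 \<bullet> w + n contact2 \<bullet> w = - (57/160) * s * Y\<^sup>2 * w $ 4"
    unfolding n_def inner_add_left[symmetric] normal_sum by (simp add: inner_4)
  have ln: "L (n u) = L u + (e * Y) *\<^sub>R L (turn u) - (19/160 * s * Y\<^sup>2) *\<^sub>R L e4" for u
    by (simp add: n_def normal_def linear_add[OF lin] linear_diff[OF lin] linear_scale[OF lin])
  have "contact0 \<bullet> L (n contact0) + contact1 \<bullet> L (n contact1) + contact2 \<bullet> L (n contact2)
    = (contact0 \<bullet> L contact0 + contact1 \<bullet> L contact1 + contact2 \<bullet> L contact2)
      + e * Y * (contact0 \<bullet> L (turn contact0) + contact1 \<bullet> L (turn contact1) + contact2 \<bullet> L (turn contact2))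
      - 19/160 * s * Y\<^sup>2 * ((contact0 + contact1 + contact2) \<bullet> L e4)"
    unfolding ln by (simp add: inner_add_left inner_add_right inner_diff_right algebra_simps)
  also have "\<dots> = 3 * p - 3 * Y * (e * \<beta>)"
    unfolding contact_block_sums[OF lin] contacts_sum_zero by (simp add: p_def \<beta>_def)
  finally have un: "contact0 \<bullet> L (n contact0) + contact1 \<bullet> L (n contact1) + contact2 \<bullet> L (n contact2) = 3 * p + 3 * Y * \<bar>\<beta>\<bar>"
    by (simp add: e)
  have dz: "(Z - x contact0)\<^sup>2 + (Z - x contact1)\<^sup>2 + (Z - x contact2)\<^sup>2 \<le> Z\<^sup>2"
  proof (rule defect_sum_le[OF x0 x0 x0])
    show "Z = max (x contact0) (max (x contact1) (x contact2))" by (simp add: Z_def lift_def x_def)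
    have "perp (L contact0) + perp (L contact1) + perp (L contact2) = perp (L (contact0 + contact1 + contact2))"
      by (simp only: linear_add[OF lin] linear_add[OF linear_perp])
    also have "\<dots> = 0" unfolding contacts_sum_zero by (simp add: linear_0[OF lin] linear_0[OF linear_perp])
    finally have z: "perp (L contact0) + perp (L contact1) + perp (L contact2) = 0" .
    have "norm X \<le> norm Y + norm Z" if "X + Y + Z = 0" for X Y Z :: "real ^ 4"
    proof -
      have "X = - (Y + Z)" using that by (simp only: eq_neg_iff_add_eq_0 add.assoc)
      hence "norm X = norm (Y + Z)" by (simp only: norm_minus_cancel)
      thus ?thesis using norm_triangle_ineq[of Y Z] by simp
    qed
    from this[of "perp (L contact0)" "perp (L contact1)" "perp (L contact2)"]
      this[of "perp (L contact1)" "perp (L contact0)" "perp (L contact2)"]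
      this[of "perp (L contact2)" "perp (L contact0)" "perp (L contact1)"] z
    show "x contact0 \<le> x contact1 + x contact2" "x contact1 \<le> x contact0 + x contact2" "x contact2 \<le> x contact0 + x contact1"
      by (simp_all add: x_def add_ac)
  qed
  \<comment> \<open>the error \<open>Y\<^sup>2 / 100\<close> accounts for \<open>\<kappa> < 1\<close>\<close>
  have quad: "99/400 * (Z + y)\<^sup>2 \<ge> 1/2 * Z\<^sup>2 + 1/2 * y\<^sup>2 - 1/4 * (Z - y)\<^sup>2 - 1/100 * Y\<^sup>2" if "0 \<le> y" "y \<le> Z" for y
  proof -
    have "(Z + y)\<^sup>2 \<le> (2 * Y)\<^sup>2" using that ZY by (intro power_mono) auto
    hence "(Z + y)\<^sup>2 \<le> 4 * Y\<^sup>2" by (simp add: power_mult_distrib)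
    moreover have "(Z + y)\<^sup>2 + (Z - y)\<^sup>2 = 2 * Z\<^sup>2 + 2 * y\<^sup>2" by (simp add: power2_eq_square algebra_simps)
    ultimately show ?thesis by linarith
  qed
  note quads = quad[OF x0 xZ[OF inC(1)]] quad[OF x0 xZ[OF inC(2)]] quad[OF x0 xZ[OF inC(3)]]
  have Zb: "3 * Y * \<bar>\<beta>\<bar> - 3/2 * \<beta>\<^sup>2 = 3/2 * Y\<^sup>2 - 3/2 * Z\<^sup>2"
    unfolding Z by (simp add: power2_eq_square algebra_simps)
  have "3 * p + 3 * Y * \<bar>\<beta>\<bar> + (99/400 * (Z + x contact0)\<^sup>2 + 99/400 * (Z + x contact1)\<^sup>2 + 99/400 * (Z + x contact2)\<^sup>2)
      - 30 * Y ^ 3 - (57/160) * s * Y\<^sup>2 * w $ 4 \<le> 3 + 189/160 * Y\<^sup>2"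
    using each[OF inC(1)] each[OF inC(2)] each[OF inC(3)] un nw by linarith
  moreover have "3 * p \<ge> 3 - 3/2 * \<beta>\<^sup>2 - 1/2 * (3/2 * h) - Y ^ 3"
    using p1(1) v2 YY Y3 ab Z4 v_def by linarith
  ultimately have sum: "31/800 * Y\<^sup>2 - 31 * Y ^ 3 \<le> (57/160) * s * Y\<^sup>2 * w $ 4"
    using quads dz sq Zb Z2 by argo
  define V where "V = s * w $ 4 * Y\<^sup>2"
  have "31/800 * Y\<^sup>2 - 31 * Y ^ 3 \<le> 57/160 * V" using sum by (simp add: V_def mult_ac)
  hence "1/20 * Y\<^sup>2 \<le> V" using Y3 zero_le_power2[of Y] by linarith
  hence "1/20 * Y\<^sup>2 \<le> s * w $ 4 * Y\<^sup>2" by (simp only: V_def)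
  thus ?thesis using Y by simp
qed

section \<open>No continuous motion leaves the standard orientation\<close>

lemma continuous_on_deviation:
  fixes \<gamma> :: "real \<Rightarrow> real ^ 4 ^ 4"
  assumes "continuous_on T \<gamma>"
  shows "continuous_on T (\<lambda>t. deviation ((*v) (transpose (\<gamma> t))))"
proof -
  have L: "continuous_on T (\<lambda>t. transpose (\<gamma> t) *v v)" for v
    unfolding transpose_def matrix_vector_mult_def
    by (intro continuous_on_vec_lambda) (auto intro!: continuous_intros assms)
  have P: "continuous_on T (\<lambda>t. perp (transpose (\<gamma> t) *v v))" for v
    by (rule linear_continuous_on_compose[OF L linear_perp])
  show ?thesis
    unfolding deviation_def lift_def sin_part_def cos_part_def
    by (intro continuous_on_add continuous_on_max continuous_on_norm continuous_on_rabs continuous_on_divide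
      continuous_on_diff continuous_on_const continuous_on_component L P) auto
qed

lemma lift_nonneg: "0 \<le> lift L"
  by (simp add: lift_def le_max_iff_disj)

lemma deviation_nonneg: "0 \<le> deviation L"
  using lift_nonneg[of L] by (simp add: deviation_def)

lemma deviation_identity: "deviation ((*v) (transpose (mat 1))) = 0"
proof -
  have "perp contact0 = 0" "perp contact1 = 0" "perp contact2 = 0"
    by (simp_all add: vec_eq_iff forall_4)
  thus ?thesis by (simp add: deviation_def lift_def sin_part_def cos_part_def transpose_mat)
qed

lemma deviation_minus_identity: "1 \<le> deviation ((*v) (transpose (- mat 1)))"
proof -
  have "transpose (- mat 1) *v v = - v" for v :: "real ^ 4"
    by (simp add: vec_eq_iff transpose_def matrix_vector_mult_def mat_def if_distrib[of "\<lambda>x. x * _"] if_distrib[of uminus] sum.delta' cong: if_cong)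
  hence "cos_part ((*v) (transpose (- mat 1))) = -1" by (simp add: cos_part_def)
  thus ?thesis using lift_nonneg[of "(*v) (transpose (- mat 1))"] unfolding deviation_def by linarith
qed

lemma minus_identity_SO: "(- mat 1 :: real ^ 4 ^ 4) \<in> SO"
proof -
  have "transpose (- mat 1) = (- mat 1 :: real ^ 4 ^ 4)"
    by (simp add: vec_eq_iff transpose_def mat_def)
  moreover have "(- mat 1) ** (- mat 1) = (mat 1 :: real ^ 4 ^ 4)"
    by (simp add: vec_eq_iff matrix_matrix_mult_def mat_def if_distrib[of "\<lambda>x. x * _"] if_distrib[of uminus] sum.delta' cong: if_cong)
  moreover have "det (- mat 1 :: real ^ 4 ^ 4) = 1"
    by (subst det_diagonal) (simp_all add: mat_def)
  ultimately show ?thesis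
    by (simp add: SO_def rotation_matrix_def orthogonal_matrix_def)
qed

lemma identity_SO: "(mat 1 :: real ^ 4 ^ 4) \<in> SO"
  by (simp add: SO_def rotation_matrix_def orthogonal_matrix_id)

lemma placed_copy_forced:
  assumes \<rho>: "\<rho> \<in> SO" and sub: "placed_copy \<rho> w shape \<subseteq> room"
    and g: "deviation ((*v) (transpose \<rho>)) = level n"
  shows "1/20 \<le> side n * w $ 4"
proof (rule blocking[OF SO_transpose[OF \<rho>] side_sq level_facts g])
  fix a u and e :: real
  assume a: "a \<in> shape_points" and u: "u \<in> contacts" and e: "e\<^sup>2 = 1"
  have "a \<in> shape" unfolding shape_def by (rule subsetD[OF closure_subset hull_inc[OF a]])
  hence "\<rho> *v a + w \<in> room" using sub by (auto simp: placed_copy_def)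
  moreover have "e \<in> {-1, 1}" using e by (auto simp: power2_eq_1_iff)
  ultimately have "normal u e (side n) (level n) \<bullet> (\<rho> *v a + w) \<le> 1 + 63/160 * (level n)\<^sup>2"
    using u unfolding room_def by blast
  thus "a \<bullet> (transpose \<rho> *v normal u e (side n) (level n)) + normal u e (side n) (level n) \<bullet> w
      \<le> 1 + 63/160 * (level n)\<^sup>2"
    by (simp add: inner_add_right inner_commute[of _ "\<rho> *v a"] inner_matrix_transpose)
qed

lemma no_path:
  fixes \<gamma> :: "real \<Rightarrow> real ^ 4 ^ 4" and \<delta> :: "real \<Rightarrow> real ^ 4"
  assumes \<gamma>: "continuous_on {0..1} \<gamma>" "\<gamma> ` {0..1} \<subseteq> SO" and \<delta>: "continuous_on {0..1} \<delta>"
    and ends: "\<gamma> 0 = mat 1" "\<gamma> 1 = - mat 1"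
    and sub: "\<And>t. t \<in> {0..1} \<Longrightarrow> placed_copy (\<gamma> t) (\<delta> t) shape \<subseteq> room"
  shows False
proof -
  define f where "f = (\<lambda>t. deviation ((*v) (transpose (\<gamma> t))))"
  have f: "continuous_on {0..1} f" unfolding f_def by (rule continuous_on_deviation[OF \<gamma>(1)])
  have f0: "f 0 = 0" and f1: "1 \<le> f 1"
    using deviation_identity deviation_minus_identity by (simp_all add: f_def ends)
  \<comment> \<open>\<open>t0\<close> is the last time at which the deviation vanishes\<close>
  define T where "T = {t \<in> {0..1}. f t = 0}"
  have "closed T" unfolding T_def by (rule continuous_closed_preimage_constant[OF f closed_atLeastAtMost])
  moreover have "bounded T" by (rule bounded_subset[of "{0..1}"]) (auto simp: T_def)
  ultimately have "compact T" by (simp add: compact_eq_bounded_closed)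
  moreover have "0 \<in> T" by (simp add: T_def f0)
  ultimately obtain t0 where t0: "t0 \<in> T" "\<And>t. t \<in> T \<Longrightarrow> t \<le> t0"
    using compact_attains_sup[of T] by blast
  have t01: "t0 \<in> {0..1}" "f t0 = 0" "t0 < 1" using t0(1) f1 by (auto simp: T_def less_le)
  have "continuous_on {0..1} (\<lambda>t. \<delta> t $ 4)" using \<delta> by (rule continuous_on_component)
  then obtain \<eta> where \<eta>: "0 < \<eta>" "\<And>t. t \<in> {0..1} \<Longrightarrow> dist t t0 < \<eta> \<Longrightarrow> dist (\<delta> t $ 4) (\<delta> t0 $ 4) < 1/20"
    using t01(1) unfolding continuous_on_iff by (metis zero_less_divide_1_iff zero_less_numeral)
  define t1 where "t1 = min 1 (t0 + \<eta> / 2)"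
  have t1: "t0 < t1" "t1 \<le> 1" "t1 \<le> t0 + \<eta> / 2" using t01 \<eta>(1) by (auto simp: t1_def)
  have "f t1 \<noteq> 0"
  proof
    assume "f t1 = 0"
    hence "t1 \<in> T" using t01 t1 by (auto simp: T_def)
    thus False using t0(2) t1 by fastforce
  qed
  hence ft1: "0 < f t1" using deviation_nonneg[of "(*v) (transpose (\<gamma> t1))"] by (simp add: f_def)
  have hit: "\<exists>t\<in>{0..1}. dist t t0 < \<eta> \<and> 1/20 \<le> side n * \<delta> t $ 4" if "level n \<le> f t1" for n
  proof -
    have "continuous_on {t0..t1} f" using t01 t1 by (intro continuous_on_subset[OF f]) auto
    hence "\<exists>t\<ge>t0. t \<le> t1 \<and> f t = level n"
      using that level_facts(1)[of n] t01(2) t1(1) by (intro IVT') auto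
    then obtain t where t: "t0 \<le> t" "t \<le> t1" "f t = level n" by blast
    hence tI: "t \<in> {0..1}" using t01 t1 by auto
    have "1/20 \<le> side n * \<delta> t $ 4"
      using \<gamma>(2) tI t(3) by (intro placed_copy_forced[OF _ sub[OF tI]]) (auto simp: f_def)
    moreover have "dist t t0 < \<eta>" using t t1 \<eta>(1) by (simp add: dist_real_def)
    ultimately show ?thesis using tI by blast
  qed
  \<comment> \<open>two consecutive levels, which have opposite sides\<close>
  obtain m where m: "(1/100000) ^ m < f t1" using real_arch_pow_inv[OF ft1, of "1/100000"] by auto
  have "level m \<le> (1/100000) ^ m" by (simp add: level_def)
  hence sm: "level m \<le> f t1" using m by simp
  hence sm': "level (Suc m) \<le> f t1" using level_less[of m "Suc m"] level_facts(1)[of "Suc m"] by simp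
  obtain t where t: "t \<in> {0..1}" "dist t t0 < \<eta>" "1/20 \<le> side m * \<delta> t $ 4" using hit[OF sm] by blast
  obtain t' where t': "t' \<in> {0..1}" "dist t' t0 < \<eta>" "1/20 \<le> - side m * \<delta> t' $ 4"
    using hit[OF sm'] by (auto simp: side_def)
  have "side m = 1 \<or> side m = -1" using side_sq[of m] by (simp only: power2_eq_1_iff)
  thus False
  proof
    assume "side m = 1"
    hence "1/20 \<le> \<delta> t $ 4" "\<delta> t' $ 4 \<le> - (1/20)" using t(3) t'(3) by simp_all
    thus False using \<eta>(2)[OF t(1,2)] \<eta>(2)[OF t'(1,2)] unfolding dist_real_def by linarith
  next
    assume "side m = -1"
    hence "\<delta> t $ 4 \<le> - (1/20)" "1/20 \<le> \<delta> t' $ 4" using t(3) t'(3) by simp_all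
    thus False using \<eta>(2)[OF t(1,2)] \<eta>(2)[OF t'(1,2)] unfolding dist_real_def by linarith
  qed
qed

theorem theorem1p3:
  shows "\<exists>(S :: (real ^ 4) set) (K :: (real ^ 4) set).
    convex_body S \<and> convex_body K \<and> kakeya S K \<and>
    (\<exists>\<rho>\<^sub>0 \<in> SO. \<exists>\<rho>\<^sub>1 \<in> SO. \<exists>w\<^sub>0 w\<^sub>1.
      placed_copy \<rho>\<^sub>0 w\<^sub>0 S \<subseteq> K \<and> placed_copy \<rho>\<^sub>1 w\<^sub>1 S \<subseteq> K \<and>
      \<not> (\<exists>(\<gamma> :: real \<Rightarrow> real ^ 4 ^ 4) (\<delta> :: real \<Rightarrow> real ^ 4).
          continuous_on {0..1} \<gamma> \<and> \<gamma> ` {0..1} \<subseteq> SO \<and> continuous_on {0..1} \<delta> \<and>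
          \<gamma> 0 = \<rho>\<^sub>0 \<and> \<gamma> 1 = \<rho>\<^sub>1 \<and> \<delta> 0 = w\<^sub>0 \<and> \<delta> 1 = w\<^sub>1 \<and>
          (\<forall>t\<in>{0..1}. placed_copy (\<gamma> t) (\<delta> t) S \<subseteq> K)))"
proof -
  obtain w\<^sub>0 where w0: "placed_copy (mat 1) w\<^sub>0 shape \<subseteq> room"
    using kakeya_shape_room identity_SO unfolding kakeya_def by blast
  obtain w\<^sub>1 where w1: "placed_copy (- mat 1) w\<^sub>1 shape \<subseteq> room"
    using kakeya_shape_room minus_identity_SO unfolding kakeya_def by blast
  have no_motion: "\<not> (\<exists>(\<gamma> :: real \<Rightarrow> real ^ 4 ^ 4) (\<delta> :: real \<Rightarrow> real ^ 4).
      continuous_on {0..1} \<gamma> \<and> \<gamma> ` {0..1} \<subseteq> SO \<and> continuous_on {0..1} \<delta> \<and>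
      \<gamma> 0 = mat 1 \<and> \<gamma> 1 = - mat 1 \<and> \<delta> 0 = w\<^sub>0 \<and> \<delta> 1 = w\<^sub>1 \<and>
      (\<forall>t\<in>{0..1}. placed_copy (\<gamma> t) (\<delta> t) shape \<subseteq> room))"
    using no_path by blast
  show ?thesis
  proof (rule exI[of _ shape], rule exI[of _ room], intro conjI convex_body_shape convex_body_room kakeya_shape_room)
    show "\<exists>\<rho>\<^sub>0 \<in> SO. \<exists>\<rho>\<^sub>1 \<in> SO. \<exists>w\<^sub>0 w\<^sub>1.
      placed_copy \<rho>\<^sub>0 w\<^sub>0 shape \<subseteq> room \<and> placed_copy \<rho>\<^sub>1 w\<^sub>1 shape \<subseteq> room \<and>
      \<not> (\<exists>(\<gamma> :: real \<Rightarrow> real ^ 4 ^ 4) (\<delta> :: real \<Rightarrow> real ^ 4).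
          continuous_on {0..1} \<gamma> \<and> \<gamma> ` {0..1} \<subseteq> SO \<and> continuous_on {0..1} \<delta> \<and>
          \<gamma> 0 = \<rho>\<^sub>0 \<and> \<gamma> 1 = \<rho>\<^sub>1 \<and> \<delta> 0 = w\<^sub>0 \<and> \<delta> 1 = w\<^sub>1 \<and>
          (\<forall>t\<in>{0..1}. placed_copy (\<gamma> t) (\<delta> t) shape \<subseteq> room))"
      by (rule bexI[OF _ identity_SO], rule bexI[OF _ minus_identity_SO], rule exI[of _ w\<^sub>0], rule exI[of _ w\<^sub>1])
        (intro conjI w0 w1 no_motion)
  qed
qed

end
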